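(* Let $G$ be a graph with $n$ vertices and $m\ge 1$ edges, and let $r$ be an integer such that one of the following holds: (a) $r\in\{2,3\}$ and $\chi(G)\le r$; (b) $r=4$ and $G$ is planar. Then \[ -\frac{m}{\binom{\chi(G)}{2}\,\theta(G)}\le -\frac{2^{r+1}m^r}{r\,n^{2r-1}}. \]
   Context: All graphs are finite and simple. $\chi(G)$ is the chromatic number and $\alpha(G)$ the independence number of $G$; for a graph on $n$ vertices, $\theta(G)=\min\{n/2,\alpha(G)\}$. (In each case $G$ is $K_{r+1}$-free, so the right-hand side is Nikiforov's upper bound for the smallest adjacency eigenvalue of a $K_{r+1}$-free graph.) *)

theory Defs
  imports "HOL-Analysis.Analysis"
begin

definition simple_graph :: "'a set \<Rightarrow> 'a set set \<Rightarrow> bool" where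
  "simple_graph V E \<longleftrightarrow> finite V \<and> (\<forall>e\<in>E. e \<subseteq> V \<and> card e = 2)"

definition proper_colouring :: "'a set \<Rightarrow> 'a set set \<Rightarrow> ('a \<Rightarrow> nat) \<Rightarrow> nat \<Rightarrow> bool" where
  "proper_colouring V E f k \<longleftrightarrow>
     (\<forall>v\<in>V. f v < k) \<and> (\<forall>u\<in>V. \<forall>v\<in>V. {u, v} \<in> E \<longrightarrow> f u \<noteq> f v)"

definition chromatic_number :: "'a set \<Rightarrow> 'a set set \<Rightarrow> nat" where
  "chromatic_number V E = (LEAST k. \<exists>f. proper_colouring V E f k)"

definition independent_set :: "'a set \<Rightarrow> 'a set set \<Rightarrow> 'a set \<Rightarrow> bool" where
  "independent_set V E S \<longleftrightarrow> S \<subseteq> V \<and> (\<forall>u\<in>S. \<forall>v\<in>S. {u, v} \<notin> E)"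

definition independence_number :: "'a set \<Rightarrow> 'a set set \<Rightarrow> nat" where
  "independence_number V E = Max {card S | S. independent_set V E S}"

definition theta :: "'a set \<Rightarrow> 'a set set \<Rightarrow> real" where
  "theta V E = min (real (card V) / 2) (real (independence_number V E))"

definition planar :: "'a set \<Rightarrow> 'a set set \<Rightarrow> bool" where
  "planar V E \<longleftrightarrow> (\<exists>(p :: 'a \<Rightarrow> complex) (\<gamma> :: 'a set \<Rightarrow> real \<Rightarrow> complex).
     inj_on p V \<and>
     (\<forall>e\<in>E. arc (\<gamma> e) \<and> {pathstart (\<gamma> e), pathfinish (\<gamma> e)} = p ` e \<and>
              path_image (\<gamma> e) \<inter> p ` V = p ` e) \<and>
     (\<forall>e\<in>E. \<forall>e'\<in>E. e \<noteq> e' \<longrightarrow> path_image (\<gamma> e) \<inter> path_image (\<gamma> e') \<subseteq> p ` (e \<inter> e')))"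

end

theory Submission
  imports Defs
begin

text \<open>With \<open>k = \<chi>(G)\<close> and \<open>t = \<theta>(G)\<close> the claim reads
  \<open>2^(r+1) m^(r-1) (k choose 2) t \<le> r n^(2r-1)\<close>. For \<open>r \<le> 3\<close> it follows from \<open>t \<le> n/2\<close> and the bound
  \<open>2km \<le> (k-1) n^2\<close> for \<open>k\<close>-colourable graphs. For planar graphs the four colour theorem is not needed:
  \<open>m \<le> 3n - 6\<close> gives \<open>k \<le> 6\<close> by degeneracy, and even \<open>k \<le> 5\<close> for \<open>n \<le> 11\<close>; together with
  \<open>t \<le> n/2\<close> and \<open>t \<le> \<alpha>(G) \<le> n + 1 - k\<close> this suffices for every \<open>n\<close>.

  Instead of Euler's formula, \<open>m \<le> 3n - 6\<close> is derived from the nonplanarity of \<open>K_5\<close> and \<open>K_{3,3}\<close>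
  in a form that is stable under contraction: vertices are drawn as disjoint continua. In a counterexample
  with the least number of vertices and exactly \<open>3n - 5\<close> edges, adjacent vertices have at least three
  common neighbours, as otherwise one could contract an edge. A vertex of degree at most 5 together with
  its neighbours then contains \<open>K_5\<close> or \<open>K_{3,3}\<close>. Both are excluded by Janiszewski's theorem.\<close>

section \<open>Nonseparating continua\<close>

text \<open>The sets to which Janiszewski's theorem is applied; points and arcs are the basic
  examples.\<close>

definition nonseparating :: "complex set \<Rightarrow> bool" where
  "nonseparating S \<longleftrightarrow> compact S \<and> connected S \<and> connected (- S)"

text \<open>The abstract form of an arc from \<open>A\<close> to \<open>B\<close> that meets them only at its ends. Unlike arcs,
  strands can be joined through a continuum without reparametrising.\<close>

definition strand :: "complex set \<Rightarrow> complex set \<Rightarrow> complex set \<Rightarrow> bool" where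
  "strand T A B \<longleftrightarrow> nonseparating T \<and> (\<exists>q s. T \<inter> A = {q} \<and> T \<inter> B = {s}) \<and>
     connected (T - A - B) \<and> T \<subseteq> closure (T - A - B)"

lemma strand_commute: "strand T A B \<longleftrightarrow> strand T B A"
proof -
  have "T - A - B = T - B - A" by blast
  then show ?thesis unfolding strand_def by metis
qed

text \<open>Janiszewski's theorem: if two compact sets do not separate the plane and their
  intersection is connected, their union does not separate it either. A single common point is the
  case needed for gluing.\<close>

lemma nonseparating_Un:
  assumes "nonseparating S" "nonseparating T" "S \<inter> T = {q}"
  shows "nonseparating (S \<union> T)"
  using assms unfolding nonseparating_def
  by (metis Janiszewski_connected compact_Un compact_imp_closed connected_Un connected_sing insert_not_empty)

lemma nonseparating_singleton: "nonseparating {q}"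
  by (simp add: nonseparating_def connected_punctured_universe)

lemma nonseparating_arc: "arc g \<Longrightarrow> nonseparating (path_image g)"
  by (simp add: nonseparating_def compact_arc_image connected_arc_image connected_arc_complement)

text \<open>A path-connected set contains an arc between any two distinct points. Equal points call
  for a one-point set, since the ends of an arc differ.\<close>

lemma nonseparating_through:
  assumes "path_connected A" "q \<in> A" "q' \<in> A"
  obtains N where "nonseparating N" "N \<subseteq> A" "q \<in> N" "q' \<in> N"
proof (cases "q = q'")
  case True
  then show ?thesis using that[of "{q}"] assms nonseparating_singleton by auto
next
  case False
  then obtain g where "arc g" "path_image g \<subseteq> A" "pathstart g = q" "pathfinish g = q'"
    using assms by (metis path_connected_arcwise)
  then show ?thesis using that[of "path_image g"] nonseparating_arc
    by (metis pathfinish_in_path_image pathstart_in_path_image)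
qed

lemma strand_arc:
  assumes "arc g" "path_image g \<inter> A = {q}" "path_image g \<inter> B = {s}"
    and "{pathstart g, pathfinish g} = {q, s}"
  shows "strand (path_image g) A B"
proof -
  have eq: "path_image g - A - B = path_image g - {pathstart g, pathfinish g}"
    using assms by blast
  also have "\<dots> = g ` {0<..<1}"
    using assms(1) by (simp add: arc_imp_simple_path simple_path_endless)
  finally have eq': "path_image g - A - B = g ` {0<..<1}" .
  have "continuous_on {0..1} g"
    using assms(1) by (simp add: arc_def path_def)
  then have "g ` closure {0<..<1} \<subseteq> closure (g ` {0<..<1})"
    by (intro image_closure_subset) (auto simp: closure_subset)
  then have "path_image g \<subseteq> closure (path_image g - A - B)"
    unfolding eq' by (simp add: path_image_def)
  moreover have "connected (path_image g - A - B)"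
    unfolding eq using assms(1) by (simp add: arc_imp_simple_path connected_simple_path_endless)
  ultimately show ?thesis
    using assms nonseparating_arc by (auto simp: strand_def)
qed

text \<open>A strand depends on \<open>A\<close> and \<open>B\<close> only through its traces on
  them. This lets a branch set grow under contraction.\<close>

lemma strand_mono:
  assumes "strand T A B" "T \<inter> A' = T \<inter> A" "T \<inter> B' = T \<inter> B"
  shows "strand T A' B'"
proof -
  have "T - A' - B' = T - A - B" using assms by blast
  then show ?thesis using assms by (simp add: strand_def)
qed

text \<open>\<open>T1\<close>, an arc or point \<open>N\<close> inside \<open>Z\<close>, and
  \<open>T2\<close> are glued at single points. The last conclusion yields an interior point of the
  new strand in \<open>Z\<close>, through which the strand can later be reached.\<close>

lemma strand_join:
  assumes T1: "strand T1 A Z" and T2: "strand T2 Z B" and Z: "path_connected Z"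
    and disj: "T1 \<inter> B = {}" "T2 \<inter> A = {}" "Z \<inter> A = {}" "Z \<inter> B = {}" "T1 \<inter> T2 \<subseteq> Z"
  obtains T where "strand T A B" "T \<subseteq> T1 \<union> Z \<union> T2" "(T - A - B) \<inter> Z \<noteq> {}"
proof -
  obtain q z1 where q: "T1 \<inter> A = {q}" and z1: "T1 \<inter> Z = {z1}"
    using T1 by (auto simp: strand_def)
  obtain s z2 where s: "T2 \<inter> B = {s}" and z2: "T2 \<inter> Z = {z2}"
    using T2 by (auto simp: strand_def)
  obtain N where N: "nonseparating N" "N \<subseteq> Z" "z1 \<in> N" "z2 \<in> N"
    using nonseparating_through[OF Z, of z1 z2] z1 z2 by blast
  define T where "T = T1 \<union> N \<union> T2"
  have n1: "nonseparating (T1 \<union> N)"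
    using T1 N z1 by (intro nonseparating_Un[of _ _ z1]) (auto simp: strand_def)
  have n: "nonseparating T"
    unfolding T_def using T2 N z1 z2 disj by (intro nonseparating_Un[OF n1, of _ z2]) (auto simp: strand_def)
  have eq: "T - A - B = (T1 - A) \<union> N \<union> (T2 - B)"
    using disj N by (auto simp: T_def)
  \<comment> \<open>Restoring the end on \<open>Z\<close> adds only a point of the closure of the
    connected interior.\<close>
  have c1: "connected (T1 - A)"
  proof (rule connected_intermediate_closure)
    show "connected (T1 - A - Z)" "T1 - A \<subseteq> closure (T1 - A - Z)"
      using T1 unfolding strand_def by (simp, blast)
  qed blast
  have c2: "connected (T2 - B)"
  proof (rule connected_intermediate_closure)
    show "connected (T2 - Z - B)" "T2 - B \<subseteq> closure (T2 - Z - B)"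
      using T2 unfolding strand_def by (simp, blast)
  qed blast
  have c: "connected (T - A - B)"
    unfolding eq
  proof (intro connected_Un)
    show "connected N" using N by (simp add: nonseparating_def)
    show "(T1 - A) \<inter> N \<noteq> {}" "(T1 - A \<union> N) \<inter> (T2 - B) \<noteq> {}"
      using z1 z2 N disj by blast+
  qed (use c1 c2 in auto)
  have "T1 - A - Z \<subseteq> T - A - B" "T2 - Z - B \<subseteq> T - A - B" "N \<subseteq> T - A - B"
    using disj N by (auto simp: T_def)
  then have "T \<subseteq> closure (T - A - B)"
    using T1 T2 closure_mono[of "T1 - A - Z" "T - A - B"] closure_mono[of "T2 - Z - B" "T - A - B"]
      closure_subset[of "T - A - B"] unfolding T_def strand_def by (meson Un_least order_trans)
  moreover have "T \<inter> A = {q}" "T \<inter> B = {s}"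
    using q s disj N by (auto simp: T_def)
  ultimately have "strand T A B"
    using n c unfolding strand_def by blast
  moreover have "T \<subseteq> T1 \<union> Z \<union> T2" "z1 \<in> (T - A - B) \<inter> Z"
    using N z1 disj by (auto simp: T_def)
  ultimately show ?thesis
    using that[of T] by blast
qed

text \<open>Follow a path from \<open>u\<close> and stop at the least parameter \<open>t\<close>
  whose image lies in \<open>K\<close>. Removing \<open>k\<close> leaves the image of
  \<open>{0..<t}\<close>, which is connected. For \<open>t = 0\<close> everything collapses to a
  point, whence the last alternative.\<close>

lemma first_hit:
  fixes D :: "'a::real_normed_vector set"
  assumes "path_connected D" "closed K" "u \<in> D" "D \<inter> K \<noteq> {}"
  obtains N k where "N \<subseteq> D" "compact N" "connected N" "u \<in> N" "N \<inter> K = {k}" "connected (N - {k})"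
    "u \<noteq> k \<or> N = {k}"
proof -
  obtain y where y: "y \<in> D" "y \<in> K" using assms by blast
  obtain g where g: "path g" "path_image g \<subseteq> D" "pathstart g = u" "pathfinish g = y"
    using assms y unfolding path_connected_def by blast
  have cont: "continuous_on {0..1} g" using g by (simp add: path_def)
  define S where "S = {t \<in> {0..1}. g t \<in> K}"
  have "S = {0..1} \<inter> g -` K" by (auto simp: S_def)
  then have "closed S" using continuous_closed_preimage[OF cont] assms by simp
  have "1 \<in> S" using y g by (auto simp: S_def pathfinish_def)
  have bb: "bdd_below S" by (rule bdd_belowI[of _ 0]) (auto simp: S_def)
  define t where "t = Inf S"
  have "t \<in> S" unfolding t_def using closed_contains_Inf \<open>1 \<in> S\<close> \<open>closed S\<close> bb by blast
  then have t: "0 \<le> t" "t \<le> 1" "g t \<in> K" by (auto simp: S_def)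
  have lt: "g v \<notin> K" if "0 \<le> v" "v < t" for v
    using that t cInf_lower[OF _ bb, of v] unfolding t_def[symmetric] by (force simp: S_def)
  have c: "continuous_on {0..t} g" "continuous_on {0..<t} g"
    using cont t by (auto intro: continuous_on_subset)
  have "g ` {0..t} - {g t} = g ` {0..<t}"
    using lt t by (force simp: less_le)
  moreover have "g ` {0..t} \<inter> K = {g t}"
    using lt t by (force simp: less_le)
  moreover have "g ` {0..t} \<subseteq> D" using g t by (auto simp: path_image_def)
  moreover have "u \<in> g ` {0..t}" using g t by (force simp: pathstart_def)
  moreover have "compact (g ` {0..t})" using c by (simp add: compact_continuous_image)
  moreover have "connected (g ` {0..t})" "connected (g ` {0..<t})"
    using c by (simp_all add: connected_continuous_image)
  moreover have "u \<noteq> g t \<or> g ` {0..t} = {g t}"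
    using lt[of 0] t g by (cases "t = 0") (auto simp: pathstart_def)
  ultimately show ?thesis using that by metis
qed

section \<open>Chords of a closed curve\<close>

definition attached :: "complex \<Rightarrow> complex set \<Rightarrow> complex set \<Rightarrow> bool" where
  "attached p T N \<longleftrightarrow> (\<exists>C. connected C \<and> p \<in> C \<and> C \<inter> T \<noteq> {} \<and> C \<inter> N = {})"

lemma attached_antimono: "attached p T N \<Longrightarrow> N' \<subseteq> N \<Longrightarrow> attached p T N'"
  unfolding attached_def by blast

text \<open>The strand may enter \<open>A\<close> at a point \<open>q\<close> off the curve. A path
  inside \<open>A\<close> from \<open>q\<close> to its first point on \<open>al\<close> prolongs it
  and stays on the side of \<open>z\<close> until then.\<close>

lemma strand_tail:
  assumes T: "strand T A B" and A: "path_connected A" and al: "closed al" "al \<noteq> {}" "K \<inter> A = al"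
    and K: "(T - A - B) \<inter> K = {}" and AB: "A \<inter> B = {}" and z: "z \<in> T - A - B"
  obtains N where "N \<subseteq> A" "compact N" "connected N" "N \<inter> T \<noteq> {}" "N \<inter> al \<noteq> {}"
    "N - K \<subseteq> connected_component_set (- K) z"
proof -
  obtain q where q: "T \<inter> A = {q}" using T by (auto simp: strand_def)
  then obtain N k where N: "N \<subseteq> A" "compact N" "connected N" "q \<in> N" "N \<inter> al = {k}"
      "connected (N - {k})" "q \<noteq> k \<or> N = {k}"
    using first_hit[OF A al(1), of q] al by blast
  have eq: "N - K = N - {k}" using N al by blast
  have "N - K \<subseteq> connected_component_set (- K) z"
  proof (cases "q = k")
    case True
    then show ?thesis using N eq by auto
  next
    case False
    have "connected (insert q (T - A - B))"
    proof (rule connected_intermediate_closure)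
      show "connected (T - A - B)" using T by (simp add: strand_def)
      show "insert q (T - A - B) \<subseteq> closure (T - A - B)"
        using T q unfolding strand_def by blast
    qed blast
    then have "connected (insert q (T - A - B) \<union> (N - {k}))"
      using N False by (intro connected_Un) auto
    moreover have "insert q (T - A - B) \<union> (N - {k}) \<subseteq> - K"
      using K N al q False by blast
    ultimately show ?thesis
      using connected_component_maximal[of z "insert q (T - A - B) \<union> (N - {k})" "- K"] z eq by blast
  qed
  then show ?thesis using that[of N] N q by blast
qed

lemma nonseparating_extend:
  assumes "strand l A B" "nonseparating al" "nonseparating be" "al \<subseteq> A" "be \<subseteq> B"
    "l \<inter> A \<subseteq> al" "l \<inter> B \<subseteq> be" "A \<inter> B = {}"
  shows "nonseparating (al \<union> l \<union> be)"
proof -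
  obtain q s where "l \<inter> A = {q}" "l \<inter> B = {s}" using assms by (auto simp: strand_def)
  then have "al \<inter> l = {q}" "(al \<union> l) \<inter> be = {s}" using assms by blast+
  then show ?thesis
    using assms nonseparating_Un by (metis strand_def)
qed

text \<open>A closed curve through the disjoint continua \<open>A\<close> and \<open>B\<close>, cut into the pieces \<open>al\<close> and
  \<open>be\<close> inside them and the two strands joining them. It need not be a simple closed curve:
  \<open>al\<close> and \<open>be\<close> may have ends sticking out.\<close>

locale ring_curve =
  fixes A B l1 l2 al be K :: "complex set"
  assumes A: "path_connected A" "compact A" and B: "path_connected B" "compact B"
    and AB: "A \<inter> B = {}"
    and l1: "strand l1 A B" and l2: "strand l2 A B" and l12: "l1 \<inter> l2 \<subseteq> A \<union> B"
    and al: "nonseparating al" "al \<subseteq> A" "l1 \<inter> A \<subseteq> al" "l2 \<inter> A \<subseteq> al"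
    and be: "nonseparating be" "be \<subseteq> B" "l1 \<inter> B \<subseteq> be" "l2 \<inter> B \<subseteq> be"
  defines "K \<equiv> al \<union> be \<union> l1 \<union> l2"
begin

lemma compacts: "compact l1" "compact l2" "compact al" "compact be" "closed K"
  using l1 l2 al be unfolding K_def strand_def nonseparating_def
  by (auto intro!: closed_Un compact_imp_closed)

lemma swap: "ring_curve A B l2 l1 al be"
  using A B AB l1 l2 l12 al be unfolding ring_curve_def by (simp add: Int_commute)

text \<open>The separation half of the Jordan curve theorem. By the dual form of Janiszewski's
  theorem, two continua whose union has connected complement meet in a connected set, but
  \<open>al \<union> l1 \<union> be\<close> and \<open>l2\<close> meet in exactly two
  points.\<close>

lemma separated: "\<exists>w. w \<notin> K \<and> \<not> connected_component (- K) z w"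
proof (rule ccontr)
  assume H: "\<not> ?thesis"
  have n: "nonseparating (al \<union> l1 \<union> be)"
    using nonseparating_extend[OF l1] al be AB by blast
  have n2: "nonseparating l2" using l2 by (simp add: strand_def)
  obtain q s where qs: "l2 \<inter> A = {q}" "l2 \<inter> B = {s}" using l2 by (auto simp: strand_def)
  then have eq: "(al \<union> l1 \<union> be) \<inter> l2 = {q, s}" "q \<noteq> s" using l12 al be AB by blast+
  have K: "K = (al \<union> l1 \<union> be) \<union> l2" by (auto simp: K_def)
  have "connected (- K)"
    using H unfolding connected_iff_connected_component
    by (metis ComplD connected_component_sym connected_component_trans)
  then have "connected {q, s}"
    unfolding eq(1)[symmetric] using n n2 K by (intro Janiszewski_dual) (auto simp: nonseparating_def)
  then show False
    using connected_finite_iff_sing[of "{q, s}"] eq(2) by auto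
qed

text \<open>As \<open>al \<union> l1 \<union> be\<close> does not separate the plane,
  \<open>w\<close> can walk towards \<open>l2\<close> while avoiding it, and the first point of
  \<open>K\<close> on the way is interior to \<open>l2\<close>. By \<open>swap\<close>, every side
  of the curve thus touches both strands.\<close>

lemma attached_component:
  assumes "w \<notin> K"
  obtains C where "connected C" "w \<in> C" "C \<inter> (l2 - A - B) \<noteq> {}" "C \<inter> (al \<union> be \<union> l1) = {}"
    "C \<subseteq> connected_component_set (- K) w \<union> (l2 - A - B)"
proof -
  define L where "L = al \<union> l1 \<union> be"
  have n: "nonseparating L"
    unfolding L_def using nonseparating_extend[OF l1] al be AB by blast
  then have "path_connected (- L)"
    by (intro connected_open_path_connected) (auto simp: nonseparating_def open_Compl compact_imp_closed)
  \<comment> \<open>A strand lies in the closure of its interior, so the interior is nonempty and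
    there is a point of \<open>K\<close> to walk to.\<close>
  have "l2 - A - B \<noteq> {}"
    using l2 unfolding strand_def by (metis closure_empty disjoint_insert(1) inf_bot_left insert_not_empty subset_empty)
  then have ne: "- L \<inter> K \<noteq> {}" using al be l12 unfolding L_def K_def by blast
  have "w \<in> - L" using assms by (auto simp: L_def K_def)
  then obtain N k where N: "N \<subseteq> - L" "connected N" "w \<in> N" "N \<inter> K = {k}" "connected (N - {k})"
    using first_hit[OF \<open>path_connected (- L)\<close> compacts(5) _ ne] by metis
  have "k \<in> N" "k \<in> K" using N by auto
  then have "k \<in> l2" "k \<notin> al" "k \<notin> be" using N by (auto simp: K_def L_def)
  then have "k \<in> l2 - A - B" using al be by blast
  moreover have "N - {k} \<subseteq> connected_component_set (- K) w"
    using N assms by (intro connected_component_maximal) auto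
  ultimately show ?thesis
    using that[of N] N unfolding L_def by blast
qed

lemma attached_join:
  assumes "attached w (l2 - A - B) S" "attached p (l2 - A - B) S" "(l2 - A - B) \<inter> S = {}"
  shows "connected_component (- S) w p"
proof -
  obtain C D where C: "connected C" "w \<in> C" "C \<inter> (l2 - A - B) \<noteq> {}" "C \<inter> S = {}"
    and D: "connected D" "p \<in> D" "D \<inter> (l2 - A - B) \<noteq> {}" "D \<inter> S = {}"
    using assms unfolding attached_def by blast
  have "connected (l2 - A - B)" using l2 by (simp add: strand_def)
  then have "connected (C \<union> (l2 - A - B) \<union> D)"
    using C D by (intro connected_Un) auto
  then show ?thesis
    unfolding connected_component_def using C D assms by (intro exI[of _ "C \<union> (l2 - A - B) \<union> D"]) auto
qed

text \<open>The chord is prolonged inside \<open>A\<close> and \<open>B\<close> until it reaches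
  \<open>al\<close> and \<open>be\<close>. Together with these it forms the continuum
  \<open>c\<close>, the common part in the later use of Janiszewski's theorem.\<close>

lemma chord_continuum:
  assumes l3: "strand l3 A B" "l1 \<inter> l3 \<subseteq> A \<union> B" "l2 \<inter> l3 \<subseteq> A \<union> B" and z: "z \<in> l3 - A - B"
  obtains c where "compact c" "connected c" "al \<union> be \<subseteq> c" "c \<subseteq> A \<union> B \<union> l3"
    "c - K \<subseteq> connected_component_set (- K) z"
proof -
  have ne: "al \<noteq> {}" "be \<noteq> {}"
    using l1 al be unfolding strand_def by blast+
  have "K \<inter> A = al" "K \<inter> B = be"
    using al be AB unfolding K_def by blast+
  have d: "(l3 - A - B) \<inter> K = {}" 
    using l3 al be unfolding K_def by blast
  obtain M where M: "M \<subseteq> A" "compact M" "connected M" "M \<inter> l3 \<noteq> {}" "M \<inter> al \<noteq> {}"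
    "M - K \<subseteq> connected_component_set (- K) z"
    using strand_tail[OF l3(1) A(1) _ ne(1) \<open>K \<inter> A = al\<close> d AB z] compacts compact_imp_closed by blast
  have d': "(l3 - B - A) \<inter> K = {}" "z \<in> l3 - B - A" "B \<inter> A = {}" "strand l3 B A"
    using d z AB by (blast, blast, blast) (use l3 strand_commute in simp)
  obtain N where N: "N \<subseteq> B" "compact N" "connected N" "N \<inter> l3 \<noteq> {}" "N \<inter> be \<noteq> {}"
    "N - K \<subseteq> connected_component_set (- K) z"
    using strand_tail[OF d'(4) B(1) _ ne(2) \<open>K \<inter> B = be\<close> d'(1,3,2)] compacts compact_imp_closed by blast
  have l3': "compact l3" "connected l3" "connected (l3 - A - B)"
    using l3 by (auto simp: strand_def nonseparating_def)
  define c where "c = l3 \<union> M \<union> N \<union> al \<union> be"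
  have "compact c" unfolding c_def using l3' M N compacts by (intro compact_Un)
  moreover have "connected c" unfolding c_def
  proof (intro connected_Un)
    show "connected al" "connected be" using al be by (simp_all add: nonseparating_def)
    show "l3 \<inter> M \<noteq> {}" "(l3 \<union> M) \<inter> N \<noteq> {}" "(l3 \<union> M \<union> N) \<inter> al \<noteq> {}"
      "(l3 \<union> M \<union> N \<union> al) \<inter> be \<noteq> {}"
      using M(4,5) N(4,5) by blast+
  qed (use l3' M N in auto)
  moreover have "l3 - A - B \<subseteq> connected_component_set (- K) z"
    using d z l3' by (intro connected_component_maximal) auto
  moreover have "l3 \<inter> A \<subseteq> M" "l3 \<inter> B \<subseteq> N"
  proof -
    obtain q s where "l3 \<inter> A = {q}" "l3 \<inter> B = {s}" using l3 by (auto simp: strand_def)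
    then show "l3 \<inter> A \<subseteq> M" "l3 \<inter> B \<subseteq> N" using M(1,4) N(1,4) by auto
  qed
  moreover have "c - K \<subseteq> (l3 - A - B) \<union> (l3 \<inter> A) \<union> (l3 \<inter> B) \<union> M \<union> N - K"
    unfolding c_def K_def by auto
  ultimately have "c - K \<subseteq> connected_component_set (- K) z"
    using M(6) N(6) by blast
  moreover have "al \<union> be \<subseteq> c" "c \<subseteq> A \<union> B \<union> l3"
    using M N al be unfolding c_def by auto
  ultimately show ?thesis
    using that[of c] \<open>compact c\<close> \<open>connected c\<close> by blast
qed

text \<open>A chord \<open>l3\<close> lies (up to the curve \<open>K\<close>) in the component of \<open>z\<close>. Two points that reach both \<open>l1\<close>
  and \<open>l2\<close> without crossing \<open>l3\<close> are separated neither by \<open>l1\<close> with the chord nor by \<open>l2\<close> with the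
  chord, and these two sets meet in a connected set, so Janiszewski's theorem applies. Points outside
  the component of \<open>z\<close> reach \<open>l1\<close> and \<open>l2\<close> automatically.\<close>

lemma chord:
  assumes l3: "strand l3 A B" "l1 \<inter> l3 \<subseteq> A \<union> B" "l2 \<inter> l3 \<subseteq> A \<union> B" and z: "z \<in> l3 - A - B"
    and w: "w \<notin> K" "\<not> connected_component (- K) z w \<or>
      attached w (l1 - A - B) (A \<union> B \<union> l2 \<union> l3) \<and> attached w (l2 - A - B) (A \<union> B \<union> l1 \<union> l3)"
    and p: "p \<notin> K" "\<not> connected_component (- K) z p \<or>
      attached p (l1 - A - B) (A \<union> B \<union> l2 \<union> l3) \<and> attached p (l2 - A - B) (A \<union> B \<union> l1 \<union> l3)"
  shows "connected_component (- K) w p"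
proof -
  obtain c where c: "compact c" "connected c" "al \<union> be \<subseteq> c" "c \<subseteq> A \<union> B \<union> l3"
    "c - K \<subseteq> connected_component_set (- K) z"
    using chord_continuum[OF l3 z] .
  interpret sw: ring_curve A B l2 l1 al be "al \<union> be \<union> l2 \<union> l1"
    using swap by simp
  have K': "al \<union> be \<union> l2 \<union> l1 = K" by (auto simp: K_def)
  \<comment> \<open>Both alternatives of the hypotheses reduce to one fact: \<open>v\<close> reaches
    each of the two strands while avoiding the other strand and \<open>c\<close>.\<close>
  have att: "attached v (l2 - A - B) (l1 \<union> c) \<and> attached v (l1 - A - B) (l2 \<union> c)"
    if v: "v \<notin> K" "\<not> connected_component (- K) z v \<or>
      attached v (l1 - A - B) (A \<union> B \<union> l2 \<union> l3) \<and> attached v (l2 - A - B) (A \<union> B \<union> l1 \<union> l3)" for v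
    using v(2)
  proof
    assume nz: "\<not> connected_component (- K) z v"
    \<comment> \<open>A side other than that of \<open>z\<close> misses \<open>c\<close>, because
      \<open>c\<close> leaves \<open>K\<close> only on the side of \<open>z\<close>.\<close>
    then have dis: "connected_component_set (- K) v \<inter> c = {}"
    proof -
      have False if "x \<in> c" "connected_component (- K) v x" for x
      proof -
        have "x \<notin> K" using connected_component_in[OF that(2)] by simp
        then have "connected_component (- K) z x" using c(5) that(1) by blast
        then show False
          using nz that(2) connected_component_sym connected_component_trans by metis
      qed
      then show ?thesis by blast
    qed
    have s: "(l2 - A - B) \<inter> c = {}" "(l1 - A - B) \<inter> c = {}"
      using c(4) l3 by blast+
    obtain C where C: "connected C" "v \<in> C" "C \<inter> (l2 - A - B) \<noteq> {}" "C \<inter> (al \<union> be \<union> l1) = {}"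
        "C \<subseteq> connected_component_set (- K) v \<union> (l2 - A - B)"
      using attached_component[OF v(1)] .
    then have "C \<inter> (l1 \<union> c) = {}" using dis s by blast
    then have "attached v (l2 - A - B) (l1 \<union> c)" using C unfolding attached_def by blast
    obtain D where D: "connected D" "v \<in> D" "D \<inter> (l1 - A - B) \<noteq> {}" "D \<inter> (al \<union> be \<union> l2) = {}"
        "D \<subseteq> connected_component_set (- K) v \<union> (l1 - A - B)"
      using sw.attached_component[of v] v(1) unfolding K' by metis
    then have "D \<inter> (l2 \<union> c) = {}" using dis s by blast
    then have "attached v (l1 - A - B) (l2 \<union> c)" using D unfolding attached_def by blast
    moreover note \<open>attached v (l2 - A - B) (l1 \<union> c)\<close>
    ultimately show ?thesis by blast
  next
    assume "attached v (l1 - A - B) (A \<union> B \<union> l2 \<union> l3) \<and> attached v (l2 - A - B) (A \<union> B \<union> l1 \<union> l3)"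
    moreover have "l2 \<union> c \<subseteq> A \<union> B \<union> l2 \<union> l3" "l1 \<union> c \<subseteq> A \<union> B \<union> l1 \<union> l3" using c by auto
    ultimately show ?thesis using attached_antimono by blast
  qed
  have "(l2 - A - B) \<inter> (l1 \<union> c) = {}" "(l1 - A - B) \<inter> (l2 \<union> c) = {}"
    using c(4) l3 l12 by blast+
  then have "connected_component (- (l1 \<union> c)) w p" "connected_component (- (l2 \<union> c)) w p"
    using att[OF w] att[OF p] attached_join sw.attached_join by blast+
  \<comment> \<open>The strands meet only within \<open>al \<union> be\<close>, which is part of
    \<open>c\<close>, so the intersection is the connected set \<open>c\<close>.\<close>
  moreover have "(l1 \<union> c) \<inter> (l2 \<union> c) = c"
  proof -
    have "l1 \<inter> l2 \<subseteq> al \<union> be" using l12 al be by blast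
    then show ?thesis using c(3) by blast
  qed
  ultimately have "connected_component (- ((l1 \<union> c) \<union> (l2 \<union> c))) w p"
    using c compacts by (intro Janiszewski[of "l1 \<union> c"]) (simp_all only: compact_Un compact_imp_closed)
  moreover have "K \<subseteq> (l1 \<union> c) \<union> (l2 \<union> c)" using c(3) by (auto simp: K_def)
  ultimately show ?thesis
    by (meson Compl_anti_mono connected_component_of_subset)
qed

end

section \<open>Nonplanarity of the two Kuratowski graphs\<close>

text \<open>Vertices are drawn as branch sets, and edges may meet only inside the branch sets of
  common ends. \<open>F_path\<close> is demanded because contraction absorbs a strand into a branch
  set, which has to stay path-connected.\<close>

locale continuum_model =
  fixes V :: "'a set" and E :: "'a set set" and X :: "'a \<Rightarrow> complex set" and F :: "'a set \<Rightarrow> complex set"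
  assumes X: "\<And>v. v \<in> V \<Longrightarrow> compact (X v) \<and> path_connected (X v)"
    and XX: "\<And>u v. u \<in> V \<Longrightarrow> v \<in> V \<Longrightarrow> u \<noteq> v \<Longrightarrow> X u \<inter> X v = {}"
    and F: "\<And>u v. u \<in> V \<Longrightarrow> v \<in> V \<Longrightarrow> u \<noteq> v \<Longrightarrow> {u, v} \<in> E \<Longrightarrow> strand (F {u, v}) (X u) (X v)"
    and F_path: "\<And>e. e \<in> E \<Longrightarrow> path_connected (F e)"
    and FX: "\<And>e w. e \<in> E \<Longrightarrow> w \<in> V \<Longrightarrow> w \<notin> e \<Longrightarrow> F e \<inter> X w = {}"
    and FF: "\<And>e e'. e \<in> E \<Longrightarrow> e' \<in> E \<Longrightarrow> e \<noteq> e' \<Longrightarrow> F e \<inter> F e' \<subseteq> \<Union>(X ` (e \<inter> e'))"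
begin

lemma FF_disjoint: "e \<in> E \<Longrightarrow> e' \<in> E \<Longrightarrow> e \<inter> e' = {} \<Longrightarrow> e \<noteq> {} \<Longrightarrow> F e \<inter> F e' = {}"
  using FF[of e e'] by fastforce

lemma XF: "e \<in> E \<Longrightarrow> w \<in> V \<Longrightarrow> w \<notin> e \<Longrightarrow> X w \<inter> F e = {}"
  using FX by blast

lemmas disjoint_simps = Int_Un_distrib Int_Un_distrib2 FX XF FF_disjoint XX

lemma connected_X: "v \<in> V \<Longrightarrow> connected (X v)"
  using X path_connected_imp_connected by blast

text \<open>Routes between branch sets. The last two stop short of the far branch set;
  \<open>no_K5\<close> uses them for a point on the edge \<open>{x, y}\<close>.\<close>

lemma bridge:
  assumes "u \<in> V" "v \<in> V" "u \<noteq> v" "{u, v} \<in> E"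
  shows "connected (X u \<union> F {u, v} \<union> X v)" "connected (X u \<union> (F {u, v} - X v))" "connected (X v \<union> (F {u, v} - X u))"
proof -
  have s: "strand (F {u, v}) (X u) (X v)" using F assms by blast
  then obtain q t where q: "F {u, v} \<inter> X u = {q}" "F {u, v} \<inter> X v = {t}" by (auto simp: strand_def)
  have d: "X u \<inter> X v = {}" using XX assms by blast
  have c: "connected (F {u, v})" "connected (F {u, v} - X u - X v)" "F {u, v} \<subseteq> closure (F {u, v} - X u - X v)"
    using s by (auto simp: strand_def nonseparating_def)
  have c1: "connected (F {u, v} - X v)" "connected (F {u, v} - X u)"
    by (rule connected_intermediate_closure[OF c(2)]; use c(3) in blast)+
  show "connected (X u \<union> F {u, v} \<union> X v)"
    using connected_X assms c q by (intro connected_Un) auto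
  have "X u \<inter> (F {u, v} - X v) \<noteq> {}" "X v \<inter> (F {u, v} - X u) \<noteq> {}"
    using q d by blast+
  then show "connected (X u \<union> (F {u, v} - X v))" "connected (X v \<union> (F {u, v} - X u))"
    using connected_X assms c1 by (intro connected_Un; simp)+
qed

text \<open>A fixed superset of the strand built from \<open>a\<close> through \<open>x\<close> to
  \<open>b\<close>, so that disjointness can be checked without knowing the strand.\<close>

definition via :: "'a \<Rightarrow> 'a \<Rightarrow> 'a \<Rightarrow> complex set" where
  "via a b x = F {a, x} \<union> X x \<union> F {b, x}"

lemma via_strand:
  assumes "distinct [a, b, x]" "{a, b, x} \<subseteq> V" "{a, x} \<in> E" "{b, x} \<in> E"
  obtains l where "strand l (X a) (X b)" "l \<subseteq> via a b x" "(l - X a - X b) \<inter> X x \<noteq> {}"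
proof (rule strand_join[of "F {a, x}" "X a" "X x" "F {b, x}" "X b"])
  have "F {a, x} \<inter> F {b, x} \<subseteq> \<Union>(X ` ({a, x} \<inter> {b, x}))"
    using assms by (intro FF) (auto simp: doubleton_eq_iff)
  then show "F {a, x} \<inter> F {b, x} \<subseteq> X x"
    using assms by auto
  show "strand (F {a, x}) (X a) (X x)" "strand (F {b, x}) (X x) (X b)"
    using assms F strand_commute by auto
  show "path_connected (X x)" using X assms by auto
  \<comment> \<open>The reversed list supplies each inequality in the opposite orientation for the
    simplifier.\<close>
  show "F {a, x} \<inter> X b = {}" "F {b, x} \<inter> X a = {}" "X x \<inter> X a = {}" "X x \<inter> X b = {}"
    using assms assms(1)[folded distinct_rev[of "[a, b, x]"]] by (simp_all add: disjoint_simps)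
qed (use that in \<open>simp add: via_def\<close>)

lemma via_Int:
  assumes "distinct [a, b, x, y]" "{a, b, x, y} \<subseteq> V" "{a, x} \<in> E" "{b, x} \<in> E" "{a, y} \<in> E" "{b, y} \<in> E"
  shows "via a b x \<inter> via a b y \<subseteq> X a \<union> X b"
proof -
  have "F {a, x} \<inter> F {a, y} \<subseteq> \<Union>(X ` ({a, x} \<inter> {a, y}))" "F {b, x} \<inter> F {b, y} \<subseteq> \<Union>(X ` ({b, x} \<inter> {b, y}))"
    using assms by (intro FF; auto simp: doubleton_eq_iff)+
  then have "F {a, x} \<inter> F {a, y} \<subseteq> X a" "F {b, x} \<inter> F {b, y} \<subseteq> X b"
    using assms by auto
  moreover have "F {a, x} \<inter> F {b, y} = {}" "F {b, x} \<inter> F {a, y} = {}" "F {a, x} \<inter> X y = {}" "F {b, x} \<inter> X y = {}"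
    "X x \<inter> F {a, y} = {}" "X x \<inter> F {b, y} = {}" "X x \<inter> X y = {}"
    using assms assms(1)[folded distinct_rev[of "[a, b, x, y]"]] by (simp_all add: disjoint_simps)
  ultimately show ?thesis unfolding via_def by blast
qed

lemma via_edge_Int:
  assumes "distinct [a, b, x]" "{a, b, x} \<subseteq> V" "{a, x} \<in> E" "{b, x} \<in> E" "{a, b} \<in> E"
  shows "via a b x \<inter> F {a, b} \<subseteq> X a \<union> X b"
proof -
  have "F {a, x} \<inter> F {a, b} \<subseteq> \<Union>(X ` ({a, x} \<inter> {a, b}))" "F {b, x} \<inter> F {a, b} \<subseteq> \<Union>(X ` ({b, x} \<inter> {a, b}))"
    using assms by (intro FF; auto simp: doubleton_eq_iff)+
  then have "F {a, x} \<inter> F {a, b} \<subseteq> X a" "F {b, x} \<inter> F {a, b} \<subseteq> X b"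
    using assms by auto
  moreover have "X x \<inter> F {a, b} = {}"
    using assms assms(1)[folded distinct_rev[of "[a, b, x]"]] by (simp_all add: disjoint_simps)
  ultimately show ?thesis unfolding via_def by blast
qed

text \<open>The two strands may end at different points of \<open>X a\<close>, so their ends are
  joined inside it by \<open>al\<close>; \<open>be\<close> does the same in
  \<open>X b\<close>.\<close>

lemma via_ring:
  assumes "distinct [a, b, x, y]" "{a, b, x, y} \<subseteq> V" "{a, x} \<in> E" "{b, x} \<in> E" "{a, y} \<in> E" "{b, y} \<in> E"
    and l1: "strand l1 (X a) (X b)" "l1 \<subseteq> via a b x" and l2: "strand l2 (X a) (X b)" "l2 \<subseteq> via a b y"
  obtains al be where "ring_curve (X a) (X b) l1 l2 al be" "al \<union> be \<union> l1 \<union> l2 \<subseteq> X a \<union> X b \<union> via a b x \<union> via a b y"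
proof -
  obtain q q' s s' where q: "l1 \<inter> X a = {q}" "l2 \<inter> X a = {q'}" "l1 \<inter> X b = {s}" "l2 \<inter> X b = {s'}"
    using l1 l2 by (auto simp: strand_def)
  have X': "compact (X a)" "path_connected (X a)" "compact (X b)" "path_connected (X b)"
    using X assms by auto
  obtain al where al: "nonseparating al" "al \<subseteq> X a" "q \<in> al" "q' \<in> al"
    using nonseparating_through[OF X'(2), of q q'] q by blast
  obtain be where be: "nonseparating be" "be \<subseteq> X b" "s \<in> be" "s' \<in> be"
    using nonseparating_through[OF X'(4), of s s'] q by blast
  have "l1 \<inter> l2 \<subseteq> X a \<union> X b" using via_Int[OF assms(1-6)] l1 l2 by blast
  moreover have "X a \<inter> X b = {}" using XX assms by auto
  ultimately have "ring_curve (X a) (X b) l1 l2 al be"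
    using X' l1 l2 al be q unfolding ring_curve_def by simp
  moreover have "al \<union> be \<union> l1 \<union> l2 \<subseteq> X a \<union> X b \<union> via a b x \<union> via a b y"
    using al be l1 l2 by auto
  ultimately show ?thesis using that by blast
qed

lemma X_nonempty: "u \<in> V \<Longrightarrow> v \<in> V \<Longrightarrow> u \<noteq> v \<Longrightarrow> {u, v} \<in> E \<Longrightarrow> X u \<noteq> {}"
  using F[of u v] by (auto simp: strand_def)

text \<open>With \<open>K\<close> the curve through \<open>a, x, b, y\<close>, the branch set of \<open>c\<close> lies on the same side of \<open>K\<close> as the
  chord through \<open>z\<close>, but the chord lemma connects it to a point on another side.\<close>

lemma no_K33:
  assumes d: "distinct [a, b, c, x, y, z]" and V: "{a, b, c, x, y, z} \<subseteq> V"
    and E: "{a, x} \<in> E" "{b, x} \<in> E" "{c, x} \<in> E" "{a, y} \<in> E" "{b, y} \<in> E" "{c, y} \<in> E"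
      "{a, z} \<in> E" "{b, z} \<in> E" "{c, z} \<in> E"
  shows False
proof -
  obtain l1 where l1: "strand l1 (X a) (X b)" "l1 \<subseteq> via a b x" "(l1 - X a - X b) \<inter> X x \<noteq> {}"
    using via_strand[of a b x] assms by auto
  obtain l2 where l2: "strand l2 (X a) (X b)" "l2 \<subseteq> via a b y" "(l2 - X a - X b) \<inter> X y \<noteq> {}"
    using via_strand[of a b y] assms by auto
  obtain l3 where l3: "strand l3 (X a) (X b)" "l3 \<subseteq> via a b z" "(l3 - X a - X b) \<inter> X z \<noteq> {}"
    using via_strand[of a b z] assms by auto
  obtain al be where ring: "ring_curve (X a) (X b) l1 l2 al be"
    and sub: "al \<union> be \<union> l1 \<union> l2 \<subseteq> X a \<union> X b \<union> via a b x \<union> via a b y"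
    using via_ring[of a b x y, OF _ _ _ _ _ _ l1(1,2) l2(1,2)] assms by auto
  define K where "K = al \<union> be \<union> l1 \<union> l2"
  interpret R: ring_curve "X a" "X b" l1 l2 al be "al \<union> be \<union> l1 \<union> l2" by (fact ring)
  obtain t where t: "t \<in> l3 - X a - X b" "t \<in> X z" using l3 by blast
  obtain p where p: "p \<in> X c" using X_nonempty[of c x] assms by auto
  have con: "connected (X c \<union> F {c, x} \<union> X x)" "connected (X c \<union> F {c, y} \<union> X y)" "connected (X c \<union> F {c, z} \<union> X z)"
    using bridge(1) assms by simp_all
  \<comment> \<open>Each route out of \<open>X c\<close> stays clear of \<open>X a\<close>,
    \<open>X b\<close> and the paths through the other two middle vertices.\<close>
  have d1: "(X c \<union> F {c, x} \<union> X x) \<inter> (X a \<union> X b \<union> via a b y \<union> via a b z) = {}"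
    "(X c \<union> F {c, y} \<union> X y) \<inter> (X a \<union> X b \<union> via a b x \<union> via a b z) = {}"
    "(X c \<union> F {c, z} \<union> X z) \<inter> (X a \<union> X b \<union> via a b x \<union> via a b y) = {}"
    using assms d[folded distinct_rev[of "[a, b, c, x, y, z]"]] unfolding via_def by (simp_all add: disjoint_simps)
  have d2: "l1 \<inter> l3 \<subseteq> X a \<union> X b" "l2 \<inter> l3 \<subseteq> X a \<union> X b"
  proof -
    have "via a b x \<inter> via a b z \<subseteq> X a \<union> X b" "via a b y \<inter> via a b z \<subseteq> X a \<union> X b"
      using assms by (simp_all add: via_Int)
    then show "l1 \<inter> l3 \<subseteq> X a \<union> X b" "l2 \<inter> l3 \<subseteq> X a \<union> X b"
      using l1(2) l2(2) l3(2) by blast+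
  qed
  have a1: "attached p (l1 - X a - X b) (X a \<union> X b \<union> l2 \<union> l3)"
    unfolding attached_def using con(1) d1(1) l1 l2 l3 p by (intro exI[of _ "X c \<union> F {c, x} \<union> X x"]) blast
  have a2: "attached p (l2 - X a - X b) (X a \<union> X b \<union> l1 \<union> l3)"
    unfolding attached_def using con(2) d1(2) l1 l2 l3 p by (intro exI[of _ "X c \<union> F {c, y} \<union> X y"]) blast
  have pK: "p \<notin> K" using d1(3) sub p K_def by blast
  \<comment> \<open>Through \<open>z\<close> the point \<open>p\<close> reaches the chord without
    meeting \<open>K\<close>.\<close>
  have tp: "connected_component (- K) t p"
    unfolding connected_component_def using con(3) d1(3) sub p t K_def
    by (intro exI[of _ "X c \<union> F {c, z} \<union> X z"]) blast
  obtain w where w: "w \<notin> K" "\<not> connected_component (- K) t w"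
    using R.separated K_def by blast
  \<comment> \<open>In the chord lemma \<open>w\<close> satisfies the first alternative and
    \<open>p\<close> the second.\<close>
  have "connected_component (- K) w p"
    unfolding K_def using R.chord[OF l3(1) d2 t(1)] a1 a2 w pK K_def by blast
  then show False
    using tp w connected_component_sym connected_component_trans by metis
qed

text \<open>Of the three chords \<open>xy\<close>, \<open>ab\<close> and \<open>azb\<close> of the curve through \<open>a, x, b, y\<close>, any two would have to lie on
  different sides, but two points off the side of \<open>azb\<close> lie on the same side.\<close>

lemma no_K5:
  assumes d: "distinct [a, b, x, y, z]" and V: "{a, b, x, y, z} \<subseteq> V"
    and E: "{a, x} \<in> E" "{b, x} \<in> E" "{a, y} \<in> E" "{b, y} \<in> E" "{a, z} \<in> E" "{b, z} \<in> E"
      "{a, b} \<in> E" "{x, y} \<in> E" "{z, x} \<in> E" "{z, y} \<in> E"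
  shows False
proof -
  obtain l1 where l1: "strand l1 (X a) (X b)" "l1 \<subseteq> via a b x" "(l1 - X a - X b) \<inter> X x \<noteq> {}"
    using via_strand[of a b x] assms by auto
  obtain l2 where l2: "strand l2 (X a) (X b)" "l2 \<subseteq> via a b y" "(l2 - X a - X b) \<inter> X y \<noteq> {}"
    using via_strand[of a b y] assms by auto
  obtain l3 where l3: "strand l3 (X a) (X b)" "l3 \<subseteq> via a b z" "(l3 - X a - X b) \<inter> X z \<noteq> {}"
    using via_strand[of a b z] assms by auto
  have l4: "strand (F {a, b}) (X a) (X b)" using F assms by auto
  obtain al be where ring: "ring_curve (X a) (X b) l1 l2 al be"
    and sub: "al \<union> be \<union> l1 \<union> l2 \<subseteq> X a \<union> X b \<union> via a b x \<union> via a b y"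
    using via_ring[of a b x y, OF _ _ _ _ _ _ l1(1,2) l2(1,2)] assms by auto
  define K where "K = al \<union> be \<union> l1 \<union> l2"
  interpret R: ring_curve "X a" "X b" l1 l2 al be "al \<union> be \<union> l1 \<union> l2" by (fact ring)
  \<comment> \<open>The points \<open>t\<close>, \<open>s\<close> and \<open>p\<close> represent the
    chords \<open>azb\<close>, \<open>ab\<close> and \<open>xy\<close>.\<close>
  obtain t where t: "t \<in> l3 - X a - X b" "t \<in> X z" using l3 by blast
  have nonempty: "T - A - B \<noteq> {}" if "strand T A B" for T A B
    using that unfolding strand_def by (metis closure_empty disjoint_insert(1) inf_bot_left insert_not_empty subset_empty)
  obtain s where s: "s \<in> F {a, b} - X a - X b" using nonempty[OF l4] by blast
  have "strand (F {x, y}) (X x) (X y)" using F assms by auto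
  then obtain p where p: "p \<in> F {x, y} - X x - X y" using nonempty by blast
  have con: "connected (X z \<union> F {z, x} \<union> X x)" "connected (X z \<union> F {z, y} \<union> X y)"
    "connected (X x \<union> (F {x, y} - X y))" "connected (X y \<union> (F {x, y} - X x))"
    using bridge assms d[folded distinct_rev[of "[a, b, x, y, z]"]] by simp_all
  have d0: "F {x, y} \<inter> (X a \<union> X b \<union> F {a, b} \<union> via a b z) = {}"
    using assms d[folded distinct_rev[of "[a, b, x, y, z]"]] unfolding via_def by (simp add: disjoint_simps)
  have d0': "F {x, y} \<inter> (F {a, x} \<union> F {b, x}) \<subseteq> X x" 
    "F {x, y} \<inter> (F {a, y} \<union> F {b, y}) \<subseteq> X y"
    using assms FF[of "{x, y}" "{a, x}"] FF[of "{x, y}" "{b, x}"] FF[of "{x, y}" "{a, y}"] FF[of "{x, y}" "{b, y}"] 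
    by (auto simp: doubleton_eq_iff)
  have d1: "(X z \<union> F {z, x} \<union> X x) \<inter> (X a \<union> X b \<union> via a b y \<union> F {a, b}) = {}"
    "(X z \<union> F {z, y} \<union> X y) \<inter> (X a \<union> X b \<union> via a b x \<union> F {a, b}) = {}"
    "X z \<inter> (X a \<union> X b \<union> via a b x \<union> via a b y) = {}" "X x \<inter> (X a \<union> X b \<union> via a b y \<union> via a b z) = {}"
    "X y \<inter> (X a \<union> X b \<union> via a b x \<union> via a b z) = {}" "X x \<inter> X y = {}" 
    "X x \<inter> F {a, b} = {}" "X y \<inter> F {a, b} = {}"
    using assms d[folded distinct_rev[of "[a, b, x, y, z]"]] unfolding via_def by (simp_all add: disjoint_simps)
  have d2: "l1 \<inter> l3 \<subseteq> X a \<union> X b" "l2 \<inter> l3 \<subseteq> X a \<union> X b"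
    "l1 \<inter> F {a, b} \<subseteq> X a \<union> X b" "l2 \<inter> F {a, b} \<subseteq> X a \<union> X b"
  proof -
    have "via a b x \<inter> via a b z \<subseteq> X a \<union> X b" "via a b y \<inter> via a b z \<subseteq> X a \<union> X b"
      "via a b x \<inter> F {a, b} \<subseteq> X a \<union> X b" "via a b y \<inter> F {a, b} \<subseteq> X a \<union> X b"
      using assms by (simp_all add: via_Int via_edge_Int)
    then show "l1 \<inter> l3 \<subseteq> X a \<union> X b" "l2 \<inter> l3 \<subseteq> X a \<union> X b"
      "l1 \<inter> F {a, b} \<subseteq> X a \<union> X b" "l2 \<inter> F {a, b} \<subseteq> X a \<union> X b"
      using l1(2) l2(2) l3(2) by blast+
  qed
  have t1: "attached t (l1 - X a - X b) (X a \<union> X b \<union> l2 \<union> F {a, b})"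
    unfolding attached_def using con(1) d1(1) l1 l2 t by (intro exI[of _ "X z \<union> F {z, x} \<union> X x"]) blast
  have t2: "attached t (l2 - X a - X b) (X a \<union> X b \<union> l1 \<union> F {a, b})"
    unfolding attached_def using con(2) d1(2) l1 l2 t by (intro exI[of _ "X z \<union> F {z, y} \<union> X y"]) blast
  \<comment> \<open>Without \<open>X y\<close>, the edge is a route from \<open>p\<close> to
    \<open>x\<close> that misses \<open>l2\<close>, since it meets the path through \<open>y\<close>
    only inside \<open>X y\<close>.\<close>
  have dx: "(X x \<union> (F {x, y} - X y)) \<inter> (X a \<union> X b \<union> l2 \<union> (l3 \<union> F {a, b})) = {}"
  proof -
    have "F {x, y} \<inter> via a b y \<subseteq> X y"
      using d0'(2) unfolding via_def by blast
    then have "(F {x, y} - X y) \<inter> (X a \<union> X b \<union> via a b y \<union> (via a b z \<union> F {a, b})) = {}"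
      using d0 by blast
    moreover have "X x \<inter> (X a \<union> X b \<union> via a b y \<union> (via a b z \<union> F {a, b})) = {}"
      using d1(4,7) by (simp add: Int_Un_distrib)
    moreover have "X a \<union> X b \<union> l2 \<union> (l3 \<union> F {a, b}) \<subseteq> X a \<union> X b \<union> via a b y \<union> (via a b z \<union> F {a, b})"
      using l2(2) l3(2) by auto
    ultimately show ?thesis by blast
  qed
  have dy: "(X y \<union> (F {x, y} - X x)) \<inter> (X a \<union> X b \<union> l1 \<union> (l3 \<union> F {a, b})) = {}"
  proof -
    have "F {x, y} \<inter> via a b x \<subseteq> X x"
      using d0'(1) unfolding via_def by blast
    then have "(F {x, y} - X x) \<inter> (X a \<union> X b \<union> via a b x \<union> (via a b z \<union> F {a, b})) = {}"
      using d0 by blast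
    moreover have "X y \<inter> (X a \<union> X b \<union> via a b x \<union> (via a b z \<union> F {a, b})) = {}"
      using d1(5,8) by (simp add: Int_Un_distrib)
    moreover have "X a \<union> X b \<union> l1 \<union> (l3 \<union> F {a, b}) \<subseteq> X a \<union> X b \<union> via a b x \<union> (via a b z \<union> F {a, b})"
      using l1(2) l3(2) by auto
    ultimately show ?thesis by blast
  qed
  have p1: "attached p (l1 - X a - X b) (X a \<union> X b \<union> l2 \<union> (l3 \<union> F {a, b}))"
    unfolding attached_def using con(3) dx l1(3) p by (intro exI[of _ "X x \<union> (F {x, y} - X y)"] conjI) blast+
  have p2: "attached p (l2 - X a - X b) (X a \<union> X b \<union> l1 \<union> (l3 \<union> F {a, b}))"
    unfolding attached_def using con(4) dy l2(3) p by (intro exI[of _ "X y \<union> (F {x, y} - X x)"] conjI) blast+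
  have p3: "attached p (l1 - X a - X b) (X a \<union> X b \<union> l2 \<union> l3)" "attached p (l2 - X a - X b) (X a \<union> X b \<union> l1 \<union> l3)"
    "attached p (l1 - X a - X b) (X a \<union> X b \<union> l2 \<union> F {a, b})" "attached p (l2 - X a - X b) (X a \<union> X b \<union> l1 \<union> F {a, b})"
    using p1 p2 by (auto elim: attached_antimono)
  have "p \<notin> via a b x" "p \<notin> via a b y" "p \<notin> X a" "p \<notin> X b"
    subgoal using p d0'(1) unfolding via_def by blast
    subgoal using p d0'(2) unfolding via_def by blast
    using p d0 by blast+
  then have pK: "p \<notin> K" using sub K_def by blast
  have tK: "t \<notin> K" using d1(3) sub t K_def by blast
  have sK: "s \<notin> K"
  proof
    assume "s \<in> K"
    then have "s \<in> al \<union> be \<union> l1 \<union> l2" by (simp add: K_def)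
    then show False using s d2 R.al R.be by blast
  qed
  note sym = connected_component_sym and trans = connected_component_trans
  \<comment> \<open>If \<open>t\<close> and \<open>p\<close> shared a side, the chord lemma for
    \<open>azb\<close> would also join \<open>p\<close> to a point off that side.\<close>
  have tp: "\<not> connected_component (- K) t p"
  proof
    assume tp: "connected_component (- K) t p"
    obtain w where w: "w \<notin> K" "\<not> connected_component (- K) t w"
      using R.separated K_def by blast
    have "connected_component (- K) w p"
      unfolding K_def using R.chord[OF l3(1) d2(1,2) t(1)] p3 w pK K_def by blast
    then show False using tp w sym trans by metis
  qed
  \<comment> \<open>The same argument for the chord \<open>ab\<close>: now \<open>t\<close> is the
    point that reaches both strands, through \<open>x\<close> and \<open>y\<close>.\<close>
  have ts: "\<not> connected_component (- K) t s"
  proof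
    assume ts: "connected_component (- K) t s"
    obtain w where w: "w \<notin> K" "\<not> connected_component (- K) s w"
      using R.separated K_def by blast
    have "connected_component (- K) w t"
      unfolding K_def using R.chord[OF l4 d2(3,4) s] t1 t2 w tK K_def by blast
    then show False using ts w sym trans by metis
  qed
  \<comment> \<open>Both points lie off the side of \<open>azb\<close>, hence on one common
    side.\<close>
  have sp: "connected_component (- K) s p"
    unfolding K_def using R.chord[OF l3(1) d2(1,2) t(1)] sK pK tp ts K_def by blast
  have st: "\<not> connected_component (- K) s t" using ts sym by metis
  \<comment> \<open>Relative to the chord \<open>ab\<close>, \<open>t\<close> is on another side and
    \<open>p\<close> reaches both strands, which forces them onto one side.\<close>
  have "connected_component (- K) t p"
    unfolding K_def using R.chord[OF l4 d2(3,4) s] st p3 tK pK K_def by blast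
  then show False using tp by blast
qed

end

section \<open>Contraction\<close>

definition drawable :: "'a set \<Rightarrow> 'a set set \<Rightarrow> bool" where
  "drawable V E \<longleftrightarrow> (\<exists>X F. continuum_model V E X F)"

lemma drawable_subgraph:
  assumes "drawable V E" "V' \<subseteq> V" "E' \<subseteq> E"
  shows "drawable V' E'"
proof -
  obtain X F where "continuum_model V E X F" using assms unfolding drawable_def by blast
  then interpret continuum_model V E X F .
  have "continuum_model V' E' X F"
    using X XX F F_path FX FF assms(2,3) by unfold_locales (meson subsetD)+
  then show ?thesis unfolding drawable_def by blast
qed

lemma edge_endpoints:
  assumes "simple_graph V E" "e \<in> E" "v \<in> e"
  obtains w where "e = {v, w}" "w \<in> V" "w \<noteq> v"
proof -
  have "card e = 2" "e \<subseteq> V" using assms by (auto simp: simple_graph_def)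
  then obtain x y where "e = {x, y}" "x \<noteq> y" by (auto simp: card_2_iff)
  then show ?thesis using that \<open>e \<subseteq> V\<close> \<open>v \<in> e\<close> by (cases "v = x") (auto simp: insert_commute)
qed

lemma edge_vertices:
  assumes "simple_graph V E" "{v, w} \<in> E"
  shows "v \<in> V" "w \<in> V" "v \<noteq> w"
  using assms unfolding simple_graph_def by force+

lemma simple_graph_finite: "simple_graph V E \<Longrightarrow> finite V \<and> finite E"
  unfolding simple_graph_def by (meson Sup_le_iff finite_UnionD finite_subset)

lemma simple_graph_card_edges: "simple_graph V E \<Longrightarrow> card E \<le> card V choose 2"
  unfolding simple_graph_def
  by (subst n_subsets[symmetric]) (auto intro!: card_mono)

text \<open>Single points serve as branch sets and the arcs of the drawing as strands.\<close>

lemma planar_imp_drawable: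
  assumes "simple_graph V E" "planar V E"
  shows "drawable V E"
proof -
  obtain p :: "'a \<Rightarrow> complex" and g :: "'a set \<Rightarrow> real \<Rightarrow> complex" where p: "inj_on p V"
    and g': "\<forall>e\<in>E. arc (g e) \<and> {pathstart (g e), pathfinish (g e)} = p ` e \<and> path_image (g e) \<inter> p ` V = p ` e"
    and gg: "\<forall>e\<in>E. \<forall>e'\<in>E. e \<noteq> e' \<longrightarrow> path_image (g e) \<inter> path_image (g e') \<subseteq> p ` (e \<inter> e')"
    using assms(2) unfolding planar_def by (elim exE conjE) (rule that)
  have g: "arc (g e) \<and> {pathstart (g e), pathfinish (g e)} = p ` e \<and> path_image (g e) \<inter> p ` V = p ` e" if "e \<in> E" for e
    using g' that by blast
  have EV: "e \<subseteq> V" if "e \<in> E" for e using assms that by (auto simp: simple_graph_def)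
  have mem: "p w \<in> path_image (g e) \<longleftrightarrow> w \<in> e" if "e \<in> E" "w \<in> V" for e w
  proof -
    have "p w \<in> path_image (g e) \<longleftrightarrow> p w \<in> p ` e" using g[OF that(1)] that(2) by blast
    also have "\<dots> \<longleftrightarrow> w \<in> e" using p EV[OF that(1)] that(2) by (auto simp: inj_on_def)
    finally show ?thesis .
  qed
  have "continuum_model V E (\<lambda>v. {p v}) (\<lambda>e. path_image (g e))"
  proof
    fix u v assume uv: "u \<in> V" "v \<in> V" "u \<noteq> v" "{u, v} \<in> E"
    then show "strand (path_image (g {u, v})) {p u} {p v}"
      using g[OF uv(4)] mem[OF uv(4)] by (intro strand_arc[of _ _ "p u" _ "p v"]) auto
  next
    fix u v assume "u \<in> V" "v \<in> V" "u \<noteq> v"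
    then show "{p u} \<inter> {p v} = {}" using p by (auto simp: inj_on_def)
  next
    fix e e' assume ee: "e \<in> E" "e' \<in> E" "e \<noteq> e'"
    have "(\<Union>v\<in>e \<inter> e'. {p v}) = p ` (e \<inter> e')" by blast
    then show "path_image (g e) \<inter> path_image (g e') \<subseteq> (\<Union>v\<in>e \<inter> e'. {p v})"
      using gg[rule_format, OF ee] by simp
  next
    fix e assume "e \<in> E"
    then show "path_connected (path_image (g e))"
      using g by (simp add: path_connected_path_image arc_imp_path)
  qed (use mem in auto)
  then show ?thesis unfolding drawable_def by blast
qed

text \<open>Edges from \<open>u\<close> and \<open>v\<close> to a common neighbour become the same
  set, so parallel edges merge by themselves.\<close>

definition contract_edges :: "'a \<Rightarrow> 'a \<Rightarrow> 'a set set \<Rightarrow> 'a set set" where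
  "contract_edges u v E = {e \<in> E. v \<notin> e} \<union> {{u, w} |w. {v, w} \<in> E \<and> w \<noteq> u}"

definition common_nbrs :: "'a set set \<Rightarrow> 'a \<Rightarrow> 'a \<Rightarrow> 'a set" where
  "common_nbrs E u v = {w. {u, w} \<in> E \<and> {v, w} \<in> E}"

context
  fixes V :: "'a set" and E :: "'a set set" and u v :: 'a
  assumes G: "simple_graph V E" and uv: "{u, v} \<in> E"
begin

text \<open>Chooses the original edge that represents a contracted one; if both
  \<open>{u, w}\<close> and \<open>{v, w}\<close> exist, the one at \<open>u\<close> is
  kept.\<close>

definition lift_edge :: "'a set \<Rightarrow> 'a set" where
  "lift_edge e = (if e \<in> E then e else insert v (e - {u}))"

lemma uvV: "u \<in> V" "v \<in> V" "u \<noteq> v"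
  using edge_vertices[OF G uv] .

lemma contract_edge_cases:
  assumes "e \<in> contract_edges u v E"
  obtains "e \<in> E" "v \<notin> e" "lift_edge e = e"
  | w where "e = {u, w}" "{v, w} \<in> E" "w \<noteq> u" "w \<noteq> v" "e \<notin> E" "lift_edge e = {v, w}"
proof (cases "e \<in> E")
  case True
  have "v \<notin> e" using assms uvV edge_vertices(3)[OF G] unfolding contract_edges_def by auto
  then show ?thesis using that(1) True by (simp add: lift_edge_def)
next
  case False
  then obtain w where w: "e = {u, w}" "{v, w} \<in> E" "w \<noteq> u"
    using assms unfolding contract_edges_def by blast
  moreover have "w \<noteq> v" using edge_vertices(3)[OF G w(2)] by simp
  moreover have "lift_edge e = {v, w}" using False w by (auto simp: lift_edge_def)
  ultimately show ?thesis using that(2) False by blast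
qed

lemma lift_edge:
  assumes "e \<in> contract_edges u v E"
  shows "lift_edge e \<in> E" "v \<notin> e" "lift_edge e - {u, v} = e - {u}" "lift_edge e \<inter> {u, v} \<noteq> {} \<Longrightarrow> u \<in> e"
    "u \<notin> e \<Longrightarrow> lift_edge e = e"
  using assms uvV by (cases rule: contract_edge_cases; auto simp: doubleton_eq_iff)+

lemma contract_simple: "simple_graph (V - {v}) (contract_edges u v E)"
  unfolding simple_graph_def
proof (intro conjI ballI)
  show "finite (V - {v})" using G by (simp add: simple_graph_def)
next
  fix e assume "e \<in> contract_edges u v E"
  then show "e \<subseteq> V - {v}" "card e = 2"
    using G uvV edge_vertices(2)[OF G]
    by (cases rule: contract_edge_cases; force simp: simple_graph_def)+
qed

text \<open>Every edge is a lift, the contracted edge itself, or an edge from \<open>v\<close> to a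
  common neighbour.\<close>

lemma card_contract_edges:
  "card E \<le> card (contract_edges u v E) + 1 + card (common_nbrs E u v)"
proof -
  have fin: "finite (contract_edges u v E)" using simple_graph_finite[OF contract_simple] by simp
  have "common_nbrs E u v \<subseteq> V"
    using edge_vertices(2)[OF G] by (auto simp: common_nbrs_def)
  then have fin': "finite (common_nbrs E u v)"
    using G finite_subset by (auto simp: simple_graph_def)
  have "E \<subseteq> lift_edge ` contract_edges u v E \<union> {{u, v}} \<union> (\<lambda>w. {v, w}) ` common_nbrs E u v"
  proof
    fix e assume e: "e \<in> E"
    show "e \<in> lift_edge ` contract_edges u v E \<union> {{u, v}} \<union> (\<lambda>w. {v, w}) ` common_nbrs E u v"
    proof (cases "v \<in> e")
      case False
      then have "e \<in> contract_edges u v E" "lift_edge e = e"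
        using e by (auto simp: contract_edges_def lift_edge_def)
      then show ?thesis by force
    next
      case True
      then obtain w where w: "e = {v, w}" "w \<noteq> v" using edge_endpoints[OF G e] by metis
      consider "w = u" | "w \<noteq> u" "{u, w} \<in> E" | "w \<noteq> u" "{u, w} \<notin> E" by blast
      then show ?thesis
      proof cases
        case 1
        then show ?thesis using w by auto
      next
        case 2
        then show ?thesis using w e by (auto simp: common_nbrs_def)
      next
        case 3
        then have "{u, w} \<in> contract_edges u v E" "lift_edge {u, w} = e"
          using e w by (auto simp: contract_edges_def lift_edge_def)
        then show ?thesis by force
      qed
    qed
  qed
  then have "card E \<le> card (lift_edge ` contract_edges u v E \<union> {{u, v}} \<union> (\<lambda>w. {v, w}) ` common_nbrs E u v)"
    using fin fin' by (intro card_mono) auto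
  also have "\<dots> \<le> card (lift_edge ` contract_edges u v E) + card {{u, v}} + card ((\<lambda>w. {v, w}) ` common_nbrs E u v)"
    by (meson add_le_mono1 card_Un_le order_trans)
  also have "\<dots> \<le> card (contract_edges u v E) + 1 + card (common_nbrs E u v)"
    using fin fin' by (intro add_mono) (auto intro: card_image_le)
  finally show ?thesis .
qed

text \<open>\<open>u\<close> receives both old branch sets and the strand between them; other edges
  keep the strand of their lift. That strand meets \<open>F {u, v}\<close> only inside the branch
  set of its own end, so its trace on the enlarged set is still one point.\<close>

lemma drawable_contract:
  assumes "drawable V E"
  shows "drawable (V - {v}) (contract_edges u v E)"
proof -
  obtain X F where "continuum_model V E X F" using assms unfolding drawable_def by blast
  then interpret continuum_model V E X F .
  define X' where "X' = X(u := X u \<union> F {u, v} \<union> X v)"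
  have X': "X' w = X w" if "w \<noteq> u" for w using that by (simp add: X'_def)
  have X'u: "X' u = X u \<union> F {u, v} \<union> X v" by (simp add: X'_def)
  have str: "strand (F {u, v}) (X u) (X v)" using F uv uvV by blast
  have strand_u: "strand (F (lift_edge {u, b})) (X' u) (X' b)"
    if b: "b \<in> V - {v}" "b \<noteq> u" "{u, b} \<in> contract_edges u v E" for b
    using b(3)
  proof (cases rule: contract_edge_cases)
    case 1
    have "F {u, b} \<inter> F {u, v} \<subseteq> \<Union>(X ` ({u, b} \<inter> {u, v}))"
      using b 1 uv by (intro FF) (auto simp: doubleton_eq_iff)
    moreover have "{u, b} \<inter> {u, v} = {u}" using b uvV by auto
    ultimately have "F {u, b} \<inter> F {u, v} \<subseteq> X u" by (simp only: image_insert image_empty Union_insert Union_empty Un_empty_right)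
    moreover have "F {u, b} \<inter> X v = {}" using FX[OF 1(1) uvV(2) 1(2)] .
    ultimately have "F {u, b} \<inter> X' u = F {u, b} \<inter> X u" unfolding X'u by blast
    moreover have "strand (F {u, b}) (X u) (X b)" using F b uvV 1 by simp
    ultimately show ?thesis
      using strand_mono[of "F {u, b}" "X u" "X b" "X' u" "X' b"] b 1 X' by simp
  next
    case (2 w)
    then have w: "w = b" using b by (auto simp: doubleton_eq_iff)
    have vb: "{v, b} \<in> E" using 2 w by simp
    have "F {v, b} \<inter> F {u, v} \<subseteq> \<Union>(X ` ({v, b} \<inter> {u, v}))"
      using b vb uv uvV by (intro FF) (auto simp: doubleton_eq_iff)
    moreover have "{v, b} \<inter> {u, v} = {v}" using b uvV by auto
    ultimately have "F {v, b} \<inter> F {u, v} \<subseteq> X v"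
      by (simp only: image_insert image_empty Union_insert Union_empty Un_empty_right)
    moreover have "F {v, b} \<inter> X u = {}" using FX[OF vb uvV(1)] b uvV by auto
    ultimately have "F {v, b} \<inter> X' u = F {v, b} \<inter> X v" unfolding X'u by blast
    moreover have "strand (F {v, b}) (X v) (X b)" using b uvV vb by (intro F) auto
    moreover have "lift_edge {u, b} = {v, b}" "X' b = X b" using 2(6) w X' b(2) by simp_all
    ultimately show ?thesis
      using strand_mono[of "F {v, b}" "X v" "X b" "X' u" "X' b"] by simp
  qed
  have "continuum_model (V - {v}) (contract_edges u v E) X' (\<lambda>e. F (lift_edge e))"
  proof
    fix w assume w: "w \<in> V - {v}"
    show "compact (X' w) \<and> path_connected (X' w)"
    proof (cases "w = u")
      case True
      have "F {u, v} \<inter> X u \<noteq> {}" "F {u, v} \<inter> X v \<noteq> {}" "compact (F {u, v})"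
        using str by (auto simp: strand_def nonseparating_def)
      then have "path_connected (X u \<union> F {u, v} \<union> X v)"
        using X F_path[OF uv] uvV by (intro path_connected_Un) auto
      then show ?thesis
        using True X uvV \<open>compact (F {u, v})\<close> unfolding True X'u by (simp add: compact_Un)
    next
      case False
      then show ?thesis using X X' w by simp
    qed
  next
    fix a b assume ab: "a \<in> V - {v}" "b \<in> V - {v}" "a \<noteq> b"
    have dis: "X' u \<inter> X w = {}" if "w \<in> V - {v}" "w \<noteq> u" for w
      using that XX[of u w] XX[of v w] FX[OF uv, of w] uvV unfolding X'u by blast
    then show "X' a \<inter> X' b = {}"
      using ab dis XX X' by (cases "a = u"; cases "b = u") (auto simp: Int_commute)
    assume e: "{a, b} \<in> contract_edges u v E"
    show "strand (F (lift_edge {a, b})) (X' a) (X' b)"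
    proof (cases "a = u \<or> b = u")
      case True
      then show ?thesis
      proof
        assume "a = u"
        then show ?thesis using strand_u[of b] ab e by simp
      next
        assume "b = u"
        then have "{a, b} = {u, a}" by blast
        then show ?thesis using strand_u[of a] ab e \<open>b = u\<close> strand_commute by simp
      qed
    next
      case False
      then have "lift_edge {a, b} = {a, b}" using lift_edge(5)[OF e] by blast
      then show ?thesis using lift_edge(1)[OF e] F[of a b] ab X' False by simp
    qed
  next
    fix e w assume e: "e \<in> contract_edges u v E" and w: "w \<in> V - {v}" "w \<notin> e"
    show "F (lift_edge e) \<inter> X' w = {}"
    proof (cases "w = u")
      case True
      then have "u \<notin> e" using w by simp
      then have eq: "lift_edge e = e" "e \<in> E" "v \<notin> e" "u \<notin> e"
        using lift_edge(1,2,5)[OF e] by simp_all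
      then have "F {u, v} \<inter> F e = {}"
        by (intro FF_disjoint[OF uv]) auto
      then have "F e \<inter> F {u, v} = {}" by blast
      moreover have "F e \<inter> X u = {}" "F e \<inter> X v = {}"
        using FX[OF eq(2) uvV(1) eq(4)] FX[OF eq(2) uvV(2) eq(3)] .
      ultimately have "F e \<inter> X' u = {}" unfolding X'u by blast
      then show ?thesis using eq(1) True by simp
    next
      case False
      then have "w \<notin> lift_edge e" using lift_edge(3)[OF e] w by blast
      then show ?thesis using FX[OF lift_edge(1)[OF e], of w] w X'[OF False] by simp
    qed
  next
    fix e e' assume e: "e \<in> contract_edges u v E" "e' \<in> contract_edges u v E" "e \<noteq> e'"
    \<comment> \<open>Lifting is injective: \<open>e - {u}\<close> can be recovered from the lift,
      and \<open>u\<close> lies in \<open>e\<close> exactly when the lift meets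
      \<open>{u, v}\<close>.\<close>
    have "lift_edge e \<noteq> lift_edge e'"
    proof
      assume eq: "lift_edge e = lift_edge e'"
      then have "e - {u} = e' - {u}" using lift_edge(3) e by metis
      moreover have "u \<in> e \<longleftrightarrow> u \<in> e'"
      proof -
        have "u \<in> e'' \<longleftrightarrow> lift_edge e'' \<inter> {u, v} \<noteq> {}" if "e'' \<in> contract_edges u v E" for e''
          using that by (cases rule: contract_edge_cases) auto
        then show ?thesis using eq e by simp
      qed
      ultimately show False using e by blast
    qed
    then have "F (lift_edge e) \<inter> F (lift_edge e') \<subseteq> \<Union>(X ` (lift_edge e \<inter> lift_edge e'))"
      using FF lift_edge e by blast
    also have "\<dots> \<subseteq> \<Union>(X' ` (e \<inter> e'))"
    proof (rule UN_least)
      fix x assume x: "x \<in> lift_edge e \<inter> lift_edge e'"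
      show "X x \<subseteq> \<Union>(X' ` (e \<inter> e'))"
      proof (cases "x \<in> {u, v}")
        case True
        then have "u \<in> e \<inter> e'" using x lift_edge(4)[OF e(1)] lift_edge(4)[OF e(2)] by blast
        moreover have "X x \<subseteq> X' u" using True X'u by auto
        ultimately show ?thesis by blast
      next
        case False
        then have "x \<in> e \<inter> e'" using x lift_edge(3)[OF e(1)] lift_edge(3)[OF e(2)] by blast
        then show ?thesis using X'[of x] False by blast
      qed
    qed
    finally show "F (lift_edge e) \<inter> F (lift_edge e') \<subseteq> \<Union>(X' ` (e \<inter> e'))" .
  qed (use F_path lift_edge(1) in blast)
  then show ?thesis unfolding drawable_def by blast
qed

end

section \<open>The edge bound\<close>

definition neighbours :: "'a set set \<Rightarrow> 'a \<Rightarrow> 'a set" where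
  "neighbours E v = {w. {v, w} \<in> E}"

lemma neighbours_subset:
  assumes "simple_graph V E"
  shows "neighbours E v \<subseteq> V - {v}" "finite (neighbours E v)"
proof -
  show "neighbours E v \<subseteq> V - {v}"
    using edge_vertices(2,3)[OF assms] by (auto simp: neighbours_def dest: not_sym)
  then show "finite (neighbours E v)"
    using simple_graph_finite[OF assms] finite_subset by blast
qed

lemma card_incident_edges:
  assumes "simple_graph V E"
  shows "card {e \<in> E. v \<in> e} = card (neighbours E v)"
proof -
  have "bij_betw (\<lambda>w. {v, w}) (neighbours E v) {e \<in> E. v \<in> e}"
    unfolding bij_betw_def
  proof
    show "inj_on (\<lambda>w. {v, w}) (neighbours E v)"
      by (auto simp: inj_on_def doubleton_eq_iff)
    show "(\<lambda>w. {v, w}) ` neighbours E v = {e \<in> E. v \<in> e}"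
    proof
      show "{e \<in> E. v \<in> e} \<subseteq> (\<lambda>w. {v, w}) ` neighbours E v"
      proof
        fix e assume "e \<in> {e \<in> E. v \<in> e}"
        then show "e \<in> (\<lambda>w. {v, w}) ` neighbours E v"
          using edge_endpoints[OF assms, of e v] unfolding neighbours_def by blast
      qed
    qed (auto simp: neighbours_def)
  qed
  then show ?thesis by (simp add: bij_betw_same_card)
qed

lemma handshake:
  assumes "simple_graph V E"
  shows "(\<Sum>v\<in>V. card (neighbours E v)) = 2 * card E"
proof -
  have fin: "finite V" "finite E" using simple_graph_finite[OF assms] by auto
  have "(\<Sum>v\<in>V. card (neighbours E v)) = (\<Sum>v\<in>V. \<Sum>e\<in>E. if v \<in> e then 1 else 0)"
    using fin by (simp add: card_incident_edges[OF assms, symmetric] sum.If_cases Int_def)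
  also have "\<dots> = (\<Sum>e\<in>E. \<Sum>v\<in>V. if v \<in> e then 1 else 0)"
    by (rule sum.swap)
  also have "\<dots> = (\<Sum>e\<in>E. 2)"
  proof (rule sum.cong)
    fix e assume "e \<in> E"
    then have "e \<subseteq> V" "card e = 2" using assms by (auto simp: simple_graph_def)
    moreover have "V \<inter> {v. v \<in> e} = e" using \<open>e \<subseteq> V\<close> by blast
    ultimately show "(\<Sum>v\<in>V. if v \<in> e then 1 else 0) = (2::nat)"
      using fin by (simp add: sum.If_cases)
  qed simp
  finally show ?thesis by simp
qed

lemma simple_graph_mono: "simple_graph V E \<Longrightarrow> E' \<subseteq> E \<Longrightarrow> simple_graph V E'"
  by (auto simp: simple_graph_def)

lemma simple_graph_delete_vertex:
  "simple_graph V E \<Longrightarrow> simple_graph (V - {v}) {e \<in> E. v \<notin> e}"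
  by (auto simp: simple_graph_def)

text \<open>Each neighbour of \<open>v\<close> is adjacent to three others, so there are 4 or 5
  neighbours. Four form a complete graph, a \<open>K_5\<close> together with \<open>v\<close>. Among
  five, each misses at most one other, and a suitable pair together with \<open>v\<close> is one
  side of a \<open>K_{3,3}\<close>.\<close>

lemma drawable_no_rich_neighbourhood:
  assumes G: "simple_graph V E" and draw: "drawable V E"
    and N: "neighbours E v \<noteq> {}" "card (neighbours E v) \<le> 5"
    and rich: "\<And>u. u \<in> neighbours E v \<Longrightarrow> 3 \<le> card (common_nbrs E v u)"
  shows False
proof -
  obtain X F where "continuum_model V E X F" using draw unfolding drawable_def by blast
  then interpret continuum_model V E X F .
  define N where "N = neighbours E v"
  have fin: "finite N" and NV: "N \<subseteq> V - {v}" using neighbours_subset[OF G] by (auto simp: N_def)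
  have vN: "{v, w} \<in> E" if "w \<in> N" for w using that by (simp add: N_def neighbours_def)
  have "v \<in> V" using N(1) edge_vertices[OF G] by (auto simp: neighbours_def)
  have sub: "common_nbrs E v u \<subseteq> N - {u}" if "u \<in> N" for u
    using edge_vertices(3)[OF G, of u] by (auto simp: common_nbrs_def N_def neighbours_def)
  \<comment> \<open>The 4 counts \<open>u\<close> itself and three common neighbours.\<close>
  have bound: "card (N - {u} - common_nbrs E v u) + 4 \<le> card N" if "u \<in> N" for u
  proof -
    have "card (N - {u} - common_nbrs E v u) = card (N - {u}) - card (common_nbrs E v u)"
      using sub[OF that] fin by (intro card_Diff_subset) (auto intro: finite_subset)
    moreover have "card (common_nbrs E v u) \<le> card (N - {u})"
      using sub[OF that] fin by (intro card_mono) auto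
    moreover have "card (N - {u}) + 1 = card N"
      using card.remove[OF fin that] by simp
    ultimately show ?thesis using rich[of u] that by (simp add: N_def)
  qed
  have adj: "{p, r} \<in> E" if "p \<in> N" "r \<in> N" "p \<noteq> r" "r \<notin> N - {p} - common_nbrs E v p" for p r
    using that by (auto simp: common_nbrs_def insert_commute)
  obtain u where "u \<in> N" using N by (auto simp: N_def)
  then have "card N = 4 \<or> card N = 5"
    using bound[of u] N by (auto simp: N_def)
  then show False
  proof
    assume 4: "card N = 4"
    have full: "{p, r} \<in> E" if "p \<in> N" "r \<in> N" "p \<noteq> r" for p r
    proof (rule adj[OF that])
      have "N - {p} - common_nbrs E v p = {}" using bound[OF that(1)] 4 fin by simp
      then show "r \<notin> N - {p} - common_nbrs E v p" by blast
    qed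
    obtain a b c d where "N = {a, b, c, d}" "distinct [a, b, c, d]"
      using 4 by (auto simp: card_Suc_eq numeral_eq_Suc)
    then show False
      using no_K5[of a b c d v] full vN NV \<open>v \<in> V\<close> by (auto simp: insert_commute)
  next
    assume 5: "card N = 5"
    have one: "r = s" if "p \<in> N" "r \<in> N" "s \<in> N" "r \<noteq> p" "s \<noteq> p" "{p, r} \<notin> E" "{p, s} \<notin> E" for p r s
    proof -
      have "card (N - {p} - common_nbrs E v p) \<le> Suc 0" using bound[OF that(1)] 5 by simp
      moreover have "r \<in> N - {p} - common_nbrs E v p" "s \<in> N - {p} - common_nbrs E v p"
        using that by (auto simp: common_nbrs_def)
      ultimately show ?thesis using fin by (auto simp: card_le_Suc0_iff_eq)
    qed
    \<comment> \<open>Vertices of a non-adjacent pair use up their only missing neighbour on each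
      other; if \<open>N\<close> is complete, any pair will do.\<close>
    obtain p q where pq: "p \<in> N" "q \<in> N" "p \<noteq> q"
      and all: "\<And>r. r \<in> N - {p, q} \<Longrightarrow> {p, r} \<in> E \<and> {q, r} \<in> E"
    proof (cases "\<exists>p\<in>N. \<exists>q\<in>N. p \<noteq> q \<and> {p, q} \<notin> E")
      case True
      then obtain p q where "p \<in> N" "q \<in> N" "p \<noteq> q" "{p, q} \<notin> E" by blast
      then show ?thesis
        using that[of p q] one[of p q] one[of q p] by (metis DiffE insertCI insert_commute)
    next
      case False
      have "card (N - {u}) = 4" using card.remove[OF fin \<open>u \<in> N\<close>] 5 by simp
      then have "N - {u} \<noteq> {}" by (metis card.empty zero_neq_numeral)
      then obtain p q where pq: "p \<in> N" "q \<in> N" "p \<noteq> q" using \<open>u \<in> N\<close> by blast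
      have full: "{x, y} \<in> E" if "x \<in> N" "y \<in> N" "x \<noteq> y" for x y
        using False that by blast
      have "{p, r} \<in> E \<and> {q, r} \<in> E" if "r \<in> N - {p, q}" for r
      proof -
        have "r \<in> N" "p \<noteq> r" "q \<noteq> r" using that by auto
        then show ?thesis using full pq by simp
      qed
      then show ?thesis by (rule that[OF pq])
    qed
    have "card (N - {p, q}) = 3" using pq 5 fin by (simp add: card_Diff_subset)
    then obtain c d e where cde: "N - {p, q} = {c, d, e}" "distinct [c, d, e]"
      by (auto simp: card_3_iff)
    then have "c \<in> N - {p, q}" "d \<in> N - {p, q}" "e \<in> N - {p, q}" by auto
    then show False
      using no_K33[of v p q c d e] all vN NV \<open>v \<in> V\<close> pq cde(2) by auto
  qed
qed

lemma drawable_card_edges: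
  assumes "simple_graph V E" "drawable V E" "3 \<le> card V"
  shows "card E + 6 \<le> 3 * card V"
  using assms
proof (induction "card V" arbitrary: V E rule: less_induct)
  case less
  note G = less.prems(1)
  show ?case
  proof (rule ccontr)
    assume neg: "\<not> ?thesis"
    have "card E \<le> card V choose 2" using simple_graph_card_edges[OF G] .
    \<comment> \<open>On three or four vertices even the complete graph has only
      \<open>3n - 6\<close> edges.\<close>
    then have n5: "5 \<le> card V"
    proof -
      have "card V \<noteq> 3" "card V \<noteq> 4"
        using neg \<open>card E \<le> card V choose 2\<close> by (auto simp: numeral_eq_Suc)
      then show ?thesis using less.prems(3) by linarith
    qed
    have finV: "finite V" using simple_graph_finite[OF G] by simp
    have "3 * card V - 5 \<le> card E" using neg by simp
    then obtain D where D: "D \<subseteq> E" "card D = 3 * card V - 5"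
      using obtain_subset_with_card_n by metis
    have GD: "simple_graph V D" using simple_graph_mono[OF G D(1)] .
    have drawD: "drawable V D" using drawable_subgraph[OF less.prems(2) _ D(1)] by blast
    have cV: "card (V - {v}) < card V" "card (V - {v}) + 1 = card V" if "v \<in> V" for v
      using card.remove[OF finV that] by simp_all
    have small: "card D' + 6 \<le> 3 * card (V - {v})"
      if "v \<in> V" "simple_graph (V - {v}) D'" "drawable (V - {v}) D'" for v D'
      using less.hyps[OF cV(1)[OF that(1)] that(2,3)] cV(2)[OF that(1)] n5 by simp
    \<comment> \<open>Contraction leaves at most \<open>3(n - 1) - 6 = 3n - 9\<close> of the
      \<open>3n - 5\<close> edges, so at least four are lost: one is \<open>{u, v}\<close>, the
      others come from common neighbours.\<close>
    have common: "3 \<le> card (common_nbrs D u v)" if "{u, v} \<in> D" for u v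
    proof -
      have v: "v \<in> V" using edge_vertices[OF GD that] by simp
      have "card (contract_edges u v D) + 6 \<le> 3 * card (V - {v})"
        using small[OF v contract_simple[OF GD that] drawable_contract[OF GD that drawD]] .
      then show ?thesis
        using card_contract_edges[OF GD that] cV(2)[OF v] D(2) n5 by simp
    qed
    \<comment> \<open>Deleting an isolated vertex would leave too many edges for the induction
      hypothesis.\<close>
    have pos: "neighbours D v \<noteq> {}" if "v \<in> V" for v
    proof
      assume "neighbours D v = {}"
      then have "{e \<in> D. v \<notin> e} = D"
        using edge_endpoints[OF GD, of _ v] unfolding neighbours_def by blast
      then have "simple_graph (V - {v}) D" using simple_graph_delete_vertex[OF GD, of v] by simp
      then show False
        using small[OF that _ drawable_subgraph[OF drawD]] cV(2)[OF that] D(2) n5 by force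
    qed
    \<comment> \<open>The degree sum is \<open>6n - 10\<close>, less than \<open>6n\<close>.\<close>
    have "\<exists>v\<in>V. card (neighbours D v) \<le> 5"
    proof (rule ccontr)
      assume "\<not> ?thesis"
      then have "(\<Sum>v\<in>V. 6) \<le> (\<Sum>v\<in>V. card (neighbours D v))"
        by (intro sum_mono) force
      then show False using handshake[OF GD] D(2) n5 by simp
    qed
    then obtain v where v: "v \<in> V" "card (neighbours D v) \<le> 5" by blast
    show False
      using drawable_no_rich_neighbourhood[OF GD drawD pos[OF v(1)] v(2)] common
      by (auto simp: neighbours_def)
  qed
qed

section \<open>Colourings\<close>

lemma chromatic_number_le: "proper_colouring V E f k \<Longrightarrow> chromatic_number V E \<le> k"
  unfolding chromatic_number_def by (rule Least_le) blast

lemma proper_colouring_inj: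
  assumes "simple_graph V E" "inj_on f V" "\<And>v. v \<in> V \<Longrightarrow> f v < k"
  shows "proper_colouring V E f k"
  using assms edge_vertices(3)[OF assms(1)] unfolding proper_colouring_def inj_on_def by metis

lemma chromatic_number_attained:
  assumes "simple_graph V E"
  obtains f where "proper_colouring V E f (chromatic_number V E)"
proof -
  obtain h where "bij_betw h V {0..<card V}"
    using ex_bij_betw_finite_nat simple_graph_finite[OF assms] by blast
  then have "proper_colouring V E h (card V)"
    by (intro proper_colouring_inj[OF assms]) (auto simp: bij_betw_def)
  then have "\<exists>k f. proper_colouring V E f k" by blast
  then have "\<exists>f. proper_colouring V E f (chromatic_number V E)"
    unfolding chromatic_number_def by (rule LeastI_ex)
  then show ?thesis using that by blast
qed

lemma chromatic_number_ge_2: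
  assumes G: "simple_graph V E" and e: "{u, v} \<in> E"
  shows "2 \<le> chromatic_number V E"
proof -
  obtain f where "proper_colouring V E f (chromatic_number V E)"
    using chromatic_number_attained[OF G] .
  then have "f u < chromatic_number V E" "f v < chromatic_number V E" "f u \<noteq> f v"
    using edge_vertices[OF G e] e unfolding proper_colouring_def by blast+
  then show ?thesis by linarith
qed

lemma independence_number:
  assumes "simple_graph V E"
  shows "\<exists>S. independent_set V E S \<and> card S = independence_number V E"
    and "independent_set V E S \<Longrightarrow> card S \<le> independence_number V E"
proof -
  have eq: "{card S |S. independent_set V E S} = card ` {S. independent_set V E S}" by blast
  have "finite {S. independent_set V E S}"
    using simple_graph_finite[OF assms] by (auto intro: finite_subset[of _ "Pow V"] simp: independent_set_def)
  then have fin: "finite {card S |S. independent_set V E S}" unfolding eq by simp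
  have "independent_set V E {}" by (simp add: independent_set_def)
  then have "{card S |S. independent_set V E S} \<noteq> {}" by blast
  then have "independence_number V E \<in> {card S |S. independent_set V E S}"
    unfolding independence_number_def by (rule Max_in[OF fin])
  then show "\<exists>S. independent_set V E S \<and> card S = independence_number V E" by auto
  show "card S \<le> independence_number V E" if "independent_set V E S"
    unfolding independence_number_def using fin that by (intro Max_ge) auto
qed

lemma independence_number_pos:
  assumes "simple_graph V E" "v \<in> V"
  shows "1 \<le> independence_number V E"
proof -
  have "independent_set V E {v}"
    using assms edge_vertices(3)[OF assms(1), of v v] by (auto simp: independent_set_def)
  then show ?thesis using independence_number(2)[OF assms(1)] by fastforce
qed

text \<open>A maximum independent set gets one colour and each remaining vertex a colour of its
  own.\<close>

lemma chromatic_plus_independence: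
  assumes G: "simple_graph V E"
  shows "chromatic_number V E + independence_number V E \<le> card V + 1"
proof -
  obtain S where S: "independent_set V E S" "card S = independence_number V E"
    using independence_number(1)[OF G] by blast
  have fin: "finite V" "S \<subseteq> V" "finite S"
    using simple_graph_finite[OF G] S finite_subset by (auto simp: independent_set_def)
  obtain h where h: "bij_betw h (V - S) {0..<card (V - S)}"
    using ex_bij_betw_finite_nat fin by blast
  define f where "f v = (if v \<in> S then 0 else Suc (h v))" for v
  have "proper_colouring V E f (card (V - S) + 1)"
    unfolding proper_colouring_def
  proof (intro conjI ballI impI)
    fix v assume "v \<in> V"
    then have "v \<notin> S \<Longrightarrow> h v < card (V - S)" using h bij_betwE by fastforce
    then show "f v < card (V - S) + 1" by (auto simp: f_def)
  next
    fix u v assume uv: "u \<in> V" "v \<in> V" "{u, v} \<in> E"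
    then have "u \<noteq> v" "\<not> (u \<in> S \<and> v \<in> S)"
      using edge_vertices(3)[OF G] S by (auto simp: independent_set_def)
    then show "f u \<noteq> f v"
      using h uv unfolding f_def bij_betw_def inj_on_def by (metis DiffI nat.inject nat.simps(3))
  qed
  then have "chromatic_number V E \<le> card (V - S) + 1" by (rule chromatic_number_le)
  then show ?thesis using S fin card_mono[OF fin(1,2)] by (simp add: card_Diff_subset)
qed

text \<open>Greedy colouring: remove a vertex of small degree, colour the rest, and note that at
  most \<open>d\<close> colours are blocked for it.\<close>

lemma degenerate_colouring:
  assumes G: "simple_graph V E"
    and deg: "\<And>S. S \<subseteq> V \<Longrightarrow> S \<noteq> {} \<Longrightarrow> \<exists>v\<in>S. card (neighbours E v \<inter> S) \<le> d"
  shows "chromatic_number V E \<le> d + 1"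
proof -
  have "\<exists>f. proper_colouring S E f (d + 1)" if "finite S" "S \<subseteq> V" for S
    using that
  proof (induction S rule: finite_psubset_induct)
    case (psubset S)
    show ?case
    proof (cases "S = {}")
      case True
      then show ?thesis by (simp add: proper_colouring_def)
    next
      case False
      then obtain v where v: "v \<in> S" "card (neighbours E v \<inter> S) \<le> d"
        using deg psubset.prems by blast
      have "S - {v} \<subset> S" "S - {v} \<subseteq> V" using v(1) psubset.prems by blast+
      then obtain f where f: "proper_colouring (S - {v}) E f (d + 1)"
        using psubset.IH by blast
      have "card (f ` (neighbours E v \<inter> S)) \<le> d"
        using v(2) psubset.hyps card_image_le[of "neighbours E v \<inter> S" f] by simp
      then have "\<not> {..<d + 1} \<subseteq> f ` (neighbours E v \<inter> S)"
        using psubset.hyps card_mono[of "f ` (neighbours E v \<inter> S)" "{..<d + 1}"] by fastforce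
      then obtain c where c: "c < d + 1" "c \<notin> f ` (neighbours E v \<inter> S)" by blast
      have "proper_colouring S E (f(v := c)) (d + 1)"
        unfolding proper_colouring_def
      proof (intro conjI ballI impI)
        fix x assume "x \<in> S"
        then show "(f(v := c)) x < d + 1" using f c by (auto simp: proper_colouring_def)
      next
        fix x y assume xy: "x \<in> S" "y \<in> S" "{x, y} \<in> E"
        then have ne: "x \<noteq> y" using edge_vertices(3)[OF G] by blast
        consider "x = v" | "y = v" | "x \<noteq> v" "y \<noteq> v" by blast
        then show "(f(v := c)) x \<noteq> (f(v := c)) y"
        proof cases
          case 1
          then have "y \<in> neighbours E v \<inter> S" using xy by (simp add: neighbours_def)
          then show ?thesis using 1 c ne by auto
        next
          case 2
          then have "x \<in> neighbours E v \<inter> S" using xy by (simp add: neighbours_def insert_commute)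
          then show ?thesis using 2 c ne by auto
        next
          case 3
          then show ?thesis using f xy by (simp add: proper_colouring_def)
        qed
      qed
      then show ?thesis by blast
    qed
  qed
  then show ?thesis
    using simple_graph_finite[OF G] chromatic_number_le by blast
qed

text \<open>An induced subgraph on \<open>s >= 3\<close> vertices has degree sum at most
  \<open>6s - 12\<close>. This is below \<open>6s\<close>, and below \<open>5s\<close> when
  \<open>s <= 11\<close>. Smaller subgraphs, outside the reach of the edge bound, are treated
  directly.\<close>

lemma drawable_chromatic_number:
  assumes G: "simple_graph V E" and draw: "drawable V E"
    and d: "d = 5 \<or> d = 4 \<and> card V \<le> 11"
  shows "chromatic_number V E \<le> d + 1"
proof (rule degenerate_colouring[OF G])
  fix S assume S: "S \<subseteq> V" "S \<noteq> {}"
  have fin: "finite V" "finite S" using simple_graph_finite[OF G] S finite_subset by auto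
  define D where "D = {e \<in> E. e \<subseteq> S}"
  have GD: "simple_graph S D" using G fin by (auto simp: simple_graph_def D_def)
  have nb: "neighbours D v = neighbours E v \<inter> S" if "v \<in> S" for v
    using that by (auto simp: neighbours_def D_def)
  show "\<exists>v\<in>S. card (neighbours E v \<inter> S) \<le> d"
  proof (cases "card S \<le> 2")
    case True
    obtain v where v: "v \<in> S" using S by blast
    have "card (neighbours D v) \<le> card (S - {v})"
      using neighbours_subset[OF GD] fin by (intro card_mono) auto
    also have "\<dots> \<le> d" using card.remove[OF fin(2) v] True d by auto
    finally show ?thesis using nb[OF v] v by auto
  next
    case False
    have "drawable S D" using drawable_subgraph[OF draw S(1)] by (auto simp: D_def)
    then have m: "card D + 6 \<le> 3 * card S" using drawable_card_edges[OF GD] False by simp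
    show ?thesis
    proof (rule ccontr)
      assume "\<not> ?thesis"
      then have "(\<Sum>v\<in>S. Suc d) \<le> (\<Sum>v\<in>S. card (neighbours D v))"
        by (intro sum_mono) (simp add: nb not_le Suc_le_eq)
      then have "card S * Suc d \<le> 2 * card D" using handshake[OF GD] by simp
      moreover have "card S \<le> card V" using S fin by (simp add: card_mono)
      ultimately show False using d m by auto
    qed
  qed
qed

text \<open>A vertex is adjacent to nothing in its own colour class. Summing degrees gives
  \<open>2m\<close> plus the sum of squared class sizes at most \<open>n^2\<close>, and by
  Cauchy-Schwarz that sum is at least \<open>n^2 / k\<close>.\<close>

lemma coloured_card_edges:
  assumes G: "simple_graph V E" and f: "proper_colouring V E f k"
  shows "2 * k * card E + (card V)\<^sup>2 \<le> k * (card V)\<^sup>2"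
proof -
  have fin: "finite V" using simple_graph_finite[OF G] by simp
  define a where "a c = card {v \<in> V. f v = c}" for c
  have deg: "card (neighbours E v) + a (f v) \<le> card V" if v: "v \<in> V" for v
  proof -
    have "neighbours E v \<inter> {w \<in> V. f w = f v} = {}" 
    proof -
      have "f v \<noteq> f w" if "w \<in> V" "{v, w} \<in> E" for w
        using f v that by (simp add: proper_colouring_def)
      then show ?thesis by (force simp: neighbours_def)
    qed
    then have "card (neighbours E v) + a (f v) = card (neighbours E v \<union> {w \<in> V. f w = f v})"
      unfolding a_def using fin neighbours_subset[OF G, of v] by (simp add: card_Un_disjoint)
    also have "\<dots> \<le> card V"
      using fin neighbours_subset[OF G, of v] by (intro card_mono) auto
    finally show ?thesis .
  qed
  have img: "f ` V \<subseteq> {..<k}" using f by (auto simp: proper_colouring_def)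
  have group: "(\<Sum>v\<in>V. g (f v)) = (\<Sum>c<k. a c * g c)" for g :: "nat \<Rightarrow> nat"
  proof -
    have "(\<Sum>v\<in>V. g (f v)) = (\<Sum>c<k. \<Sum>v | v \<in> V \<and> f v = c. g (f v))"
      using sum.group[OF fin finite_lessThan img, of "\<lambda>v. g (f v)"] by simp
    then show ?thesis by (simp add: a_def)
  qed
  have "2 * card E + (\<Sum>c<k. a c * a c) = (\<Sum>v\<in>V. card (neighbours E v) + a (f v))"
    using handshake[OF G] group[of a] by (simp add: sum.distrib)
  also have "\<dots> \<le> (\<Sum>v\<in>V. card V)" using deg by (intro sum_mono)
  finally have 1: "2 * card E + (\<Sum>c<k. a c * a c) \<le> (card V)\<^sup>2" by (simp add: power2_eq_square)
  have "card V = (\<Sum>c<k. a c)" using group[of "\<lambda>_. 1"] by simp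
  then have "real ((card V)\<^sup>2) = (\<Sum>c<k. real (a c))\<^sup>2" by simp
  also have "\<dots> \<le> (\<Sum>c<k. (real (a c))\<^sup>2) * real k"
    using sum_squared_le_sum_of_squares[where I = "{..<k}" and f = "\<lambda>c. real (a c)"] by simp
  also have "\<dots> = real ((\<Sum>c<k. a c * a c) * k)" by (simp add: power2_eq_square)
  finally have "(card V)\<^sup>2 \<le> (\<Sum>c<k. a c * a c) * k" by linarith
  then have "2 * k * card E + (card V)\<^sup>2 \<le> k * (2 * card E + (\<Sum>c<k. a c * a c))"
    by (simp add: algebra_simps)
  also have "\<dots> \<le> k * (card V)\<^sup>2" using 1 by (rule mult_le_mono2)
  finally show ?thesis .
qed

section \<open>The inequality\<close>

text \<open>For \<open>n >= 8\<close> the bound \<open>t <= n/2\<close> is enough and the claim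
  becomes \<open>108 c (n - 2)^3 <= n^6\<close> with \<open>c\<close> bounding the binomial
  coefficient. For \<open>n <= 7\<close> finitely many pairs \<open>n\<close>, \<open>k\<close> are
  checked with both bounds on \<open>t\<close>; at \<open>n = 7\<close>, \<open>k = 5\<close> the
  value \<open>n/2\<close> alone would be too large.\<close>

lemma planar_bound_arith:
  fixes n m k :: nat and t :: real
  assumes n: "3 \<le> n" and m: "m + 6 \<le> 3 * n" and k: "2 \<le> k" "k \<le> 6" "n \<le> 11 \<Longrightarrow> k \<le> 5"
    and t: "0 \<le> t" "t \<le> real n / 2" "t \<le> real n + 1 - real k"
  shows "8 * real m ^ 3 * real (k choose 2) * t \<le> real n ^ 7"
proof -
  define w where "w = real m ^ 3 * t"
  have le: "8 * (real (k choose 2) * w) \<le> 8 * (c * ((3 * real n - 6) ^ 3 * b))"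
    if "real (k choose 2) \<le> c" "t \<le> b" for c b
  proof -
    have "real m \<le> 3 * real n - 6" using m by linarith
    then have "real m ^ 3 \<le> (3 * real n - 6) ^ 3" by (intro power_mono) auto
    then have "w \<le> (3 * real n - 6) ^ 3 * b"
      unfolding w_def using that(2) t(1) n by (intro mult_mono) auto
    moreover have "0 \<le> w" using t(1) by (simp add: w_def)
    moreover have "0 \<le> c" using that(1) by (meson of_nat_0_le_iff order_trans)
    ultimately have "real (k choose 2) * w \<le> c * ((3 * real n - 6) ^ 3 * b)"
      using that(1) by (intro mult_mono[of "real (k choose 2)"]) auto
    then show ?thesis by simp
  qed
  have c: "k = 2 \<or> k = 3 \<or> k = 4 \<or> k = 5 \<or> k = 6" using k by linarith
  have ch: "(2 choose 2) = (1::nat)" "(3 choose 2) = (3::nat)" "(4 choose 2) = (6::nat)" "(5 choose 2) = (10::nat)" "(6 choose 2) = (15::nat)"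
    by (simp_all add: choose_two)
  have "8 * (real (k choose 2) * w) \<le> real n ^ 7"
  proof (cases "n \<ge> 8")
    case True
    obtain c where cc: "real (k choose 2) \<le> c" "108 * c * (real n - 2) ^ 3 \<le> real n ^ 6"
    proof (cases "n \<ge> 12")
      case True
      have "real (k choose 2) \<le> 15" using c by (auto simp: ch)
      \<comment> \<open>\<open>1620 = 108 * 15\<close>, just below
        \<open>12^3 = 1728\<close>.\<close>
      moreover have "1620 * (real n - 2) ^ 3 \<le> real n ^ 6"
      proof -
        have "1620 \<le> (12::real) ^ 3" by simp
        also have "\<dots> \<le> real n ^ 3" using True by (intro power_mono) auto
        finally have "1620 * (real n - 2) ^ 3 \<le> real n ^ 3 * real n ^ 3"
          using n by (intro mult_mono power_mono) auto
        then show ?thesis by (simp flip: power_add)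
      qed
      ultimately show ?thesis by (intro that[of 15]) auto
    next
      case False
      then have "n = 8 \<or> n = 9 \<or> n = 10 \<or> n = 11" using \<open>n \<ge> 8\<close> by linarith
      moreover have "k \<le> 5" using k(3) False by simp
      then have "real (k choose 2) \<le> 10" using c by (auto simp: ch)
      ultimately show ?thesis by (intro that[of 10]) auto
    qed
    have "8 * (real (k choose 2) * w) \<le> 8 * (c * ((3 * real n - 6) ^ 3 * (real n / 2)))"
      using le[OF cc(1) t(2)] .
    also have "\<dots> = (108 * c * (real n - 2) ^ 3) * real n"
    proof -
      have "3 * real n - 6 = 3 * (real n - 2)" by simp
      then show ?thesis by (simp only: power_mult_distrib) simp
    qed
    also have "\<dots> \<le> real n ^ 6 * real n" using cc(2) by (intro mult_right_mono) auto
    finally show ?thesis by (simp flip: power_Suc2)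
  next
    case False
    then have "n = 3 \<or> n = 4 \<or> n = 5 \<or> n = 6 \<or> n = 7" using n by linarith
    moreover have "k = 2 \<or> k = 3 \<or> k = 4 \<or> k = 5" using c k(3) False by linarith
    moreover have "8 * (real (k choose 2) * w)
        \<le> 8 * (real (k choose 2) * ((3 * real n - 6) ^ 3 * min (real n / 2) (real n + 1 - real k)))"
      using le[OF order_refl, of "min (real n / 2) (real n + 1 - real k)"] t by simp
    ultimately show ?thesis by (elim disjE) (simp_all add: ch)
  qed
  then show ?thesis by (simp add: w_def mult_ac)
qed

theorem theorem4p2:
  fixes V :: "'a set" and E :: "'a set set" and r :: nat
  assumes "simple_graph V E"
    and "card E \<ge> 1"
    and "(r \<in> {2, 3} \<and> chromatic_number V E \<le> r) \<or> (r = 4 \<and> planar V E)"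
  shows "- real (card E) / (real (chromatic_number V E choose 2) * theta V E)
           \<le> - (2 ^ (r + 1) * real (card E) ^ r) / (real r * real (card V) ^ (2 * r - 1))"
proof -
  note G = assms(1)
  define n m k t where "n = card V" and "m = card E" and "k = chromatic_number V E" and "t = theta V E"
  note defs = n_def m_def k_def t_def
  have "E \<noteq> {}" using assms(2) by auto
  then obtain u v where uv: "{u, v} \<in> E"
    using G by (metis all_not_in_conv card_2_iff simple_graph_def)
  have V: "u \<in> V" "v \<in> V" "u \<noteq> v" using edge_vertices[OF G uv] .
  have fin: "finite V" using simple_graph_finite[OF G] by simp
  have "card {u, v} \<le> card V" using V fin by (intro card_mono) auto
  then have n: "2 \<le> n" using V by (simp add: defs)
  have k: "2 \<le> k" using chromatic_number_ge_2[OF G uv] by (simp add: defs)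
  have "1 \<le> independence_number V E" using independence_number_pos[OF G V(1)] .
  then have t: "0 < t" "t \<le> real n / 2" "t \<le> real n + 1 - real k"
    using n chromatic_plus_independence[OF G] by (auto simp: defs theta_def)
  have m: "0 < m" using assms(2) by (simp add: defs)
  have C: "0 < real (k choose 2)" using k by (simp add: zero_less_binomial)
  obtain f where f: "proper_colouring V E f k"
    using chromatic_number_attained[OF G] by (auto simp: defs)
  have turan: "2 * k * m + n\<^sup>2 \<le> k * n\<^sup>2"
    using coloured_card_edges[OF G f] by (simp add: defs)
  \<comment> \<open>The claim with denominators cleared and one factor \<open>m\<close>
    cancelled.\<close>
  have key: "2 ^ (r + 1) * real m ^ (r - 1) * real (k choose 2) * t \<le> real r * real n ^ (2 * r - 1)"
    using assms(3)
  proof (elim disjE conjE)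
    assume r: "r \<in> {2, 3}" and kr: "chromatic_number V E \<le> r"
    have "k = 2 \<or> r = 3 \<and> k = 3" using r kr k by (auto simp: defs)
    then show ?thesis
    proof (elim disjE conjE)
      assume k2: "k = 2"
      have "4 * m \<le> n\<^sup>2" using turan k2 by simp
      then have m4: "4 * real m \<le> real n ^ 2"
        by (metis of_nat_le_iff of_nat_mult of_nat_numeral of_nat_power)
      have m16: "(4 * real m) ^ 2 \<le> (real n ^ 2) ^ 2" using m4 by (intro power_mono) auto
      show ?thesis
      proof (cases "r = 2")
        case True
        have "(8 * real m) * t \<le> (2 * real n ^ 2) * (real n / 2)"
          using m4 t by (intro mult_mono[of "8 * real m"]) auto
        also have "\<dots> \<le> 2 * real n ^ 3" by (simp add: power2_eq_square power3_eq_cube)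
        finally show ?thesis using True k2 by simp
      next
        case False
        then have r3: "r = 3" using r by simp
        have "(16 * real m ^ 2) * t \<le> (real n ^ 2) ^ 2 * (real n / 2)"
          using m16 t by (intro mult_mono[of "16 * real m ^ 2"]) (auto simp: power_mult_distrib)
        also have "\<dots> = real n ^ 5 / 2" by (simp add: eval_nat_numeral)
        also have "\<dots> \<le> 3 * real n ^ 5" by simp
        finally show ?thesis using r3 k2 by simp
      qed
    next
      assume r3: "r = 3" and k3: "k = 3"
      have "3 * m \<le> n\<^sup>2" using turan k3 by simp
      then have m3: "3 * real m \<le> real n ^ 2"
        by (metis of_nat_le_iff of_nat_mult of_nat_numeral of_nat_power)
      then have "(3 * real m) ^ 2 \<le> (real n ^ 2) ^ 2" by (intro power_mono) auto
      \<comment> \<open>Here 48 is \<open>2^4\<close> times the binomial coefficient 3, and the 9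
        comes from \<open>(3m)^2\<close>.\<close>
      then have "(48 * real m ^ 2) * t \<le> (48 / 9 * (real n ^ 2) ^ 2) * (real n / 2)"
        using t by (intro mult_mono[of "48 * real m ^ 2"]) (auto simp: power_mult_distrib)
      also have "\<dots> = 24 / 9 * real n ^ 5" by (simp add: eval_nat_numeral)
      also have "\<dots> \<le> 3 * real n ^ 5" by simp
      finally show ?thesis using r3 k3 by (simp add: choose_two)
    qed
  next
    assume r: "r = 4" and "planar V E"
    then have draw: "drawable V E" using planar_imp_drawable[OF G] by blast
    \<comment> \<open>For \<open>r = 4\<close> both sides of the claim are divided by 4. The case
      \<open>n = 2\<close> is separate because the edge bound starts at three vertices.\<close>
    have "8 * real m ^ 3 * real (k choose 2) * t \<le> real n ^ 7"
    proof (cases "n = 2")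
      case True
      have "m \<le> n choose 2" using simple_graph_card_edges[OF G] by (simp add: defs)
      then have "m = 1" using True m by simp
      moreover have "k = 2" using t(1,3) True k by linarith
      ultimately show ?thesis using True t(2) by simp
    next
      case False
      then have n3: "3 \<le> n" using n by simp
      show ?thesis
        using planar_bound_arith[OF n3, of m k t] drawable_card_edges[OF G draw] k t n3
          drawable_chromatic_number[OF G draw, of 5] drawable_chromatic_number[OF G draw, of 4]
        by (simp add: defs)
    qed
    then show ?thesis using r by (simp add: mult_ac)
  qed
  have r: "0 < r" using assms(3) by auto
  have "2 ^ (r + 1) * real m ^ r / (real r * real n ^ (2 * r - 1)) \<le> real m / (real (k choose 2) * t)"
  proof -
    have "real m ^ r = real m ^ (r - 1) * real m" using r by (metis power_minus_mult)
    then have "2 ^ (r + 1) * real m ^ r * (real (k choose 2) * t)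
        = (2 ^ (r + 1) * real m ^ (r - 1) * real (k choose 2) * t) * real m"
      by simp
    also have "\<dots> \<le> (real r * real n ^ (2 * r - 1)) * real m"
      using key by (rule mult_right_mono) simp
    finally show ?thesis
      using r n C t(1) by (simp add: divide_le_eq le_divide_eq mult.commute)
  qed
  then show ?thesis by (simp add: defs)
qed

end
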